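(* OTM-effectivity differs strictly from classical truth: every OTM-effective $\in$-statement in prenex normal form is true, but there is a true $\in$-statement in prenex normal form that is not OTM-effective.
   Context: Ordinal Turing machines (OTMs, Koepke) run Turing programs on tapes whose cells are indexed by all ordinals (each cell contains 0 or 1), in ordinal time; at limit times, cell contents, inner state and head position are the inferior limits of the earlier values. OTM-computations may use an ordinal parameter $\rho$ (marked on the scratch tape at the start); a pair $(P,\rho)$ is a parameter-program. A code for a set $x$ is a set of ordinals $\{p(\iota,\xi): \iota,\xi<\alpha,\ f(\iota)\in f(\xi)\}$, where $p$ is Cantor's ordinal pairing function, $\alpha$ is an ordinal and $f:\alpha\to \mathrm{tc}(\{x\})$ is a bijection with $f(0)=x$. Sets are given to and output by OTMs via codes. An effectivizer of $\forall x_0\exists y_0\ldots\forall x_n\exists y_n\,\psi$ ($\psi$ quantifier-free) is a class function $F:V\to V$ such that $\psi(x_0,F((x_0)),\ldots,x_n,F((x_0,\ldots,x_n)))$ holds for all $x_0,\ldots,x_n$. An encoding of $F$ is a class function $\hat F:\mathfrak{P}(\mathrm{On})\to\mathfrak{P}(\mathrm{On})$ such that, whenever $c_x$ codes $x$, $\hat F(c_x)$ codes $F(x)$. A statement is OTM-effective if some effectivizer of it has an encoding that is computable by a parameter-program $(P,\rho)$. *)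

theory Defs
  imports Main
begin

section \<open>The universe of sets\<close>

text \<open>
  The universe \<open>V\<close> is a type that satisfies the axioms of ZFC. Class functions \<open>V \<rightarrow> V\<close> are the HOL
  functions on this type, and separation and replacement range over HOL predicates and functions.
\<close>

class zfc =
  fixes mem :: "'a \<Rightarrow> 'a \<Rightarrow> bool"  (infix "\<in>\<^sub>V" 50)
  assumes extensionality: "(\<And>z. z \<in>\<^sub>V x \<longleftrightarrow> z \<in>\<^sub>V y) \<Longrightarrow> x = y"
    and foundation: "y \<in>\<^sub>V x \<Longrightarrow> \<exists>y. y \<in>\<^sub>V x \<and> (\<forall>z. z \<in>\<^sub>V y \<longrightarrow> \<not> z \<in>\<^sub>V x)"
    and pairing: "\<exists>u. x \<in>\<^sub>V u \<and> y \<in>\<^sub>V u"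
    and union: "\<exists>u. \<forall>y z. z \<in>\<^sub>V y \<longrightarrow> y \<in>\<^sub>V x \<longrightarrow> z \<in>\<^sub>V u"
    and power_set: "\<exists>u. \<forall>y. (\<forall>z. z \<in>\<^sub>V y \<longrightarrow> z \<in>\<^sub>V x) \<longrightarrow> y \<in>\<^sub>V u"
    and infinity: "\<exists>w. (\<exists>e. e \<in>\<^sub>V w \<and> (\<forall>z. \<not> z \<in>\<^sub>V e)) \<and>
      (\<forall>x. x \<in>\<^sub>V w \<longrightarrow> (\<exists>y. y \<in>\<^sub>V w \<and> (\<forall>z. z \<in>\<^sub>V y \<longleftrightarrow> z \<in>\<^sub>V x \<or> z = x)))"
    and separation: "\<exists>y. \<forall>z. z \<in>\<^sub>V y \<longleftrightarrow> z \<in>\<^sub>V x \<and> P z"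
    and replacement: "\<exists>y. \<forall>z. z \<in>\<^sub>V x \<longrightarrow> f z \<in>\<^sub>V y"
    and choice: "(\<And>y. y \<in>\<^sub>V x \<Longrightarrow> \<exists>z. z \<in>\<^sub>V y) \<Longrightarrow>
      (\<And>y y' z. y \<in>\<^sub>V x \<Longrightarrow> y' \<in>\<^sub>V x \<Longrightarrow> z \<in>\<^sub>V y \<Longrightarrow> z \<in>\<^sub>V y' \<Longrightarrow> y = y') \<Longrightarrow>
      \<exists>c. \<forall>y. y \<in>\<^sub>V x \<longrightarrow> (\<exists>!z. z \<in>\<^sub>V y \<and> z \<in>\<^sub>V c)"

definition elts :: "'v::zfc \<Rightarrow> 'v set"
  where "elts x = {y. y \<in>\<^sub>V x}"

text \<open>Meaningful only if \<open>A\<close> is not a proper class.\<close>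

definition set_of :: "'v::zfc set \<Rightarrow> 'v"
  where "set_of A = (THE x. elts x = A)"

definition upair :: "'v::zfc \<Rightarrow> 'v \<Rightarrow> 'v"
  where "upair x y = set_of {x, y}"

definition opair :: "'v::zfc \<Rightarrow> 'v \<Rightarrow> 'v"
  where "opair x y = upair (upair x x) (upair x y)"

primrec vnat :: "nat \<Rightarrow> 'v::zfc" where
  "vnat 0 = set_of {}"
| "vnat (Suc n) = set_of (insert (vnat n) (elts (vnat n)))"

text \<open>
  Finite sequences are functions on a natural number, so that the one-term sequence of \<open>x\<close> is not
  \<open>x\<close> itself and sequences of different lengths are different.
\<close>

definition tuple :: "'v::zfc list \<Rightarrow> 'v"
  where "tuple xs = set_of {opair (vnat i) (xs ! i) | i. i < length xs}"

definition tc :: "'v::zfc \<Rightarrow> 'v set"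
  where "tc x = \<Inter>{T. elts x \<subseteq> T \<and> (\<forall>y\<in>T. elts y \<subseteq> T)}"


section \<open>Ordinals\<close>

definition transitive_set :: "'v::zfc \<Rightarrow> bool"
  where "transitive_set x \<longleftrightarrow> (\<forall>y z. z \<in>\<^sub>V y \<longrightarrow> y \<in>\<^sub>V x \<longrightarrow> z \<in>\<^sub>V x)"

definition Ord :: "'v::zfc \<Rightarrow> bool"
  where "Ord x \<longleftrightarrow> transitive_set x \<and> (\<forall>y. y \<in>\<^sub>V x \<longrightarrow> transitive_set y)"

lemma Ord_mem: "Ord x \<Longrightarrow> y \<in>\<^sub>V x \<Longrightarrow> Ord y"
  unfolding Ord_def transitive_set_def by blast

lemma Ord_trans: "Ord x \<Longrightarrow> y \<in>\<^sub>V x \<Longrightarrow> z \<in>\<^sub>V y \<Longrightarrow> z \<in>\<^sub>V x"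
  unfolding Ord_def transitive_set_def by blast

lemma Ord_minimal:
  assumes "Ord a" "P a"
  shows "\<exists>b. Ord b \<and> P b \<and> (\<forall>c. c \<in>\<^sub>V b \<longrightarrow> \<not> P c)"
proof (cases "\<exists>c. c \<in>\<^sub>V a \<and> P c")
  case True
  then obtain c where c: "c \<in>\<^sub>V a" "P c"
    by auto
  obtain s where s: "\<forall>z. z \<in>\<^sub>V s \<longleftrightarrow> z \<in>\<^sub>V a \<and> P z"
    using separation[of a P] ..
  with c have "c \<in>\<^sub>V s"
    by simp
  then obtain b where b: "b \<in>\<^sub>V s" "\<forall>z. z \<in>\<^sub>V b \<longrightarrow> \<not> z \<in>\<^sub>V s"
    using foundation by metis
  have "b \<in>\<^sub>V a" "P b"
    using b(1) s by simp_all
  moreover have "\<not> P z" if "z \<in>\<^sub>V b" for z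
    using b(2) s that Ord_trans[OF assms(1) \<open>b \<in>\<^sub>V a\<close> that] by simp
  ultimately show ?thesis
    using Ord_mem[OF assms(1)] by auto
next
  case False
  with assms show ?thesis
    by auto
qed

lemma Ord_irrefl: "Ord a \<Longrightarrow> \<not> a \<in>\<^sub>V a"
  using Ord_minimal[of a "\<lambda>x. x \<in>\<^sub>V x"] by blast

lemma Ord_linear:
  assumes "Ord a" "Ord b"
  shows "a \<in>\<^sub>V b \<or> a = b \<or> b \<in>\<^sub>V a"
proof (rule ccontr)
  define R where "R = (\<lambda>x y. x \<in>\<^sub>V y \<or> x = y \<or> y \<in>\<^sub>V (x :: 'a))"
  assume "\<not> ?thesis"
  then have "\<exists>y. Ord y \<and> \<not> R a y"
    using assms by (auto simp: R_def)
  then obtain x where x: "Ord x" "\<exists>y. Ord y \<and> \<not> R x y"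
    "\<forall>z. z \<in>\<^sub>V x \<longrightarrow> \<not> (\<exists>y. Ord y \<and> \<not> R z y)"
    using Ord_minimal[of a "\<lambda>x. \<exists>y. Ord y \<and> \<not> R x y"] assms by blast
  then obtain y where y: "Ord y" "\<not> R x y" "\<forall>z. z \<in>\<^sub>V y \<longrightarrow> R x z"
    using Ord_minimal[of _ "\<lambda>y. \<not> R x y"] by blast
  have "z \<in>\<^sub>V x \<longleftrightarrow> z \<in>\<^sub>V y" for z
    using x(1,3) y Ord_trans[OF x(1)] Ord_trans[OF y(1)] unfolding R_def by blast
  then have "x = y"
    by (rule extensionality)
  then show False
    using y(2) by (simp add: R_def)
qed

lemma Ord_empty: "\<forall>z. \<not> z \<in>\<^sub>V x \<Longrightarrow> Ord x"
  by (simp add: Ord_def transitive_set_def)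

lemma ex_greater_Ord:
  assumes "Ord a"
  shows "\<exists>b. Ord b \<and> a \<in>\<^sub>V b"
proof -
  obtain u where u: "a \<in>\<^sub>V u"
    using pairing[of a a] by auto
  obtain p where p: "\<forall>z. z \<in>\<^sub>V p \<longleftrightarrow> z \<in>\<^sub>V u \<and> z = a"
    using separation[of u "\<lambda>z. z = a"] ..
  obtain q where q: "a \<in>\<^sub>V q" "p \<in>\<^sub>V q"
    using pairing[of a p] by auto
  obtain w where w: "\<forall>y z. z \<in>\<^sub>V y \<longrightarrow> y \<in>\<^sub>V q \<longrightarrow> z \<in>\<^sub>V w"
    using union[of q] ..
  obtain b where b: "\<forall>z. z \<in>\<^sub>V b \<longleftrightarrow> z \<in>\<^sub>V w \<and> (z \<in>\<^sub>V a \<or> z = a)"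
    using separation[of w "\<lambda>z. z \<in>\<^sub>V a \<or> z = a"] ..
  have aw: "a \<in>\<^sub>V w"
    using w p q(2) u by auto
  have "z \<in>\<^sub>V w" if "z \<in>\<^sub>V a" for z
    using w that q(1) by auto
  with aw b have b': "z \<in>\<^sub>V b \<longleftrightarrow> z \<in>\<^sub>V a \<or> z = a" for z
    by auto
  have "transitive_set b"
    unfolding transitive_set_def b' using Ord_trans[OF assms] by auto
  moreover have "transitive_set y" if "y \<in>\<^sub>V b" for y
    using that assms unfolding b' Ord_def by auto
  ultimately have "Ord b"
    by (simp add: Ord_def)
  then show ?thesis
    using b' by blast
qed

typedef (overloaded) 'v ordinal = "{x :: 'v::zfc. Ord x}"
  using infinity Ord_empty by blast

lemma Ord_Rep_ordinal: "Ord (Rep_ordinal a)"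
  using Rep_ordinal by blast

instantiation ordinal :: (zfc) linorder
begin

definition less_ordinal :: "'a ordinal \<Rightarrow> 'a ordinal \<Rightarrow> bool"
  where "a < b \<longleftrightarrow> Rep_ordinal a \<in>\<^sub>V Rep_ordinal b"

definition less_eq_ordinal :: "'a ordinal \<Rightarrow> 'a ordinal \<Rightarrow> bool"
  where "a \<le> b \<longleftrightarrow> a < b \<or> a = b" for a b :: "'a ordinal"

instance
proof
  fix a b c :: "'a ordinal"
  have irrefl: "\<not> x < x" for x :: "'a ordinal"
    by (simp add: less_ordinal_def Ord_irrefl Ord_Rep_ordinal)
  have trans: "x < y \<Longrightarrow> y < z \<Longrightarrow> x < z" for x y z :: "'a ordinal"
    using Ord_trans[OF Ord_Rep_ordinal] by (auto simp: less_ordinal_def)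
  show "a < b \<longleftrightarrow> a \<le> b \<and> \<not> b \<le> a"
    using irrefl trans by (auto simp: less_eq_ordinal_def)
  show "a \<le> a"
    by (simp add: less_eq_ordinal_def)
  show "a \<le> b \<Longrightarrow> b \<le> c \<Longrightarrow> a \<le> c"
    using trans by (auto simp: less_eq_ordinal_def)
  show "a \<le> b \<Longrightarrow> b \<le> a \<Longrightarrow> a = b"
    using irrefl trans by (auto simp: less_eq_ordinal_def)
  show "a \<le> b \<or> b \<le> a"
    using Ord_linear[OF Ord_Rep_ordinal Ord_Rep_ordinal]
    by (auto simp: less_eq_ordinal_def less_ordinal_def Rep_ordinal_inject)
qed

end

instance ordinal :: (zfc) wellorder
proof
  fix P :: "'a ordinal \<Rightarrow> bool" and a
  assume step: "\<And>x. (\<And>y. y < x \<Longrightarrow> P y) \<Longrightarrow> P x"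
  show "P a"
  proof (rule ccontr)
    assume "\<not> P a"
    then obtain b where b: "Ord b" "\<not> P (Abs_ordinal b)" "\<forall>c. c \<in>\<^sub>V b \<longrightarrow> P (Abs_ordinal c)"
      using Ord_minimal[of "Rep_ordinal a" "\<lambda>x. \<not> P (Abs_ordinal x)"] Ord_Rep_ordinal
      by (auto simp: Rep_ordinal_inverse)
    have "P y" if "y < Abs_ordinal b" for y
    proof -
      have "Rep_ordinal y \<in>\<^sub>V b"
        using that b(1) by (simp add: less_ordinal_def Abs_ordinal_inverse)
      with b(3) have "P (Abs_ordinal (Rep_ordinal y))"
        by simp
      then show ?thesis
        by (simp add: Rep_ordinal_inverse)
    qed
    then show False
      using b(2) step by blast
  qed
qed

instance ordinal :: (zfc) no_top
proof
  fix a :: "'a ordinal"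
  obtain b where "Ord b" "Rep_ordinal a \<in>\<^sub>V b"
    using ex_greater_Ord[OF Ord_Rep_ordinal] by blast
  then have "a < Abs_ordinal b"
    by (simp add: less_ordinal_def Abs_ordinal_inverse)
  then show "\<exists>b. a < b" ..
qed

instantiation ordinal :: (zfc) conditionally_complete_linorder
begin

definition inf_ordinal :: "'a ordinal \<Rightarrow> 'a ordinal \<Rightarrow> 'a ordinal"
  where "inf_ordinal = min"

definition sup_ordinal :: "'a ordinal \<Rightarrow> 'a ordinal \<Rightarrow> 'a ordinal"
  where "sup_ordinal = max"

definition Inf_ordinal :: "'a ordinal set \<Rightarrow> 'a ordinal"
  where "Inf A = (LEAST a. a \<in> A)" for A :: "'a ordinal set"

definition Sup_ordinal :: "'a ordinal set \<Rightarrow> 'a ordinal"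
  where "Sup A = (LEAST b. \<forall>a\<in>A. a \<le> b)" for A :: "'a ordinal set"

instance
proof
  fix x z :: "'a ordinal" and X :: "'a ordinal set"
  show "x \<in> X \<Longrightarrow> bdd_below X \<Longrightarrow> Inf X \<le> x"
    by (simp add: Inf_ordinal_def Least_le)
  show "z \<le> Inf X" if X: "X \<noteq> {}" "\<And>x. x \<in> X \<Longrightarrow> z \<le> x"
  proof -
    obtain y where "y \<in> X"
      using X(1) by auto
    then have "Inf X \<in> X"
      unfolding Inf_ordinal_def by (rule LeastI)
    then show ?thesis
      by (rule X(2))
  qed
  show "x \<le> Sup X" if x: "x \<in> X" "bdd_above X"
  proof -
    obtain b where "\<forall>a\<in>X. a \<le> b"
      using x(2) by (auto simp: bdd_above_def)
    then have "\<forall>a\<in>X. a \<le> Sup X"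
      unfolding Sup_ordinal_def by (rule LeastI)
    with x(1) show ?thesis by simp
  qed
  show "X \<noteq> {} \<Longrightarrow> (\<And>x. x \<in> X \<Longrightarrow> x \<le> z) \<Longrightarrow> Sup X \<le> z"
    unfolding Sup_ordinal_def by (simp add: Least_le)
qed (auto simp: inf_ordinal_def sup_ordinal_def max_min_distrib2)

end

instantiation ordinal :: (zfc) zero
begin

definition zero_ordinal :: "'a ordinal"
  where "0 = (LEAST a :: 'a ordinal. True)"

instance ..

end

definition succ :: "'v::zfc ordinal \<Rightarrow> 'v ordinal"
  where "succ a = (LEAST b. a < b)"

definition limit :: "'v::zfc ordinal \<Rightarrow> bool"
  where "limit a \<longleftrightarrow> a \<noteq> 0 \<and> (\<forall>b. a \<noteq> succ b)"

text \<open>A class of ordinals belongs to \<open>\<PP>(On)\<close> iff it is a set.\<close>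

definition Pow_On :: "'v::zfc ordinal set set"
  where "Pow_On = {X. \<exists>x. Rep_ordinal ` X = elts x}"

text \<open>
  The ordinal pairing function is the isomorphism from the canonical well-ordering of \<open>On \<times> On\<close>
  (by maximum, then lexicographically) onto \<open>On\<close>.
\<close>

definition pair_less :: "'v::zfc ordinal \<times> 'v ordinal \<Rightarrow> 'v ordinal \<times> 'v ordinal \<Rightarrow> bool"
  where "pair_less = (\<lambda>(a, b) (c, d).
    max a b < max c d \<or> max a b = max c d \<and> (a < c \<or> a = c \<and> b < d))"

definition ord_pair :: "'v::zfc ordinal \<times> 'v ordinal \<Rightarrow> 'v ordinal"
  where "ord_pair = (THE p. bij p \<and> (\<forall>u v. p u < p v \<longleftrightarrow> pair_less u v))"

definition codes :: "'v::zfc ordinal set \<Rightarrow> 'v \<Rightarrow> bool"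
  where "codes c x \<longleftrightarrow> (\<exists>\<alpha> f. bij_betw f {..<\<alpha>} (tc (set_of {x})) \<and> f 0 = x \<and>
    c = {ord_pair (\<iota>, \<xi>) | \<iota> \<xi>. \<iota> < \<alpha> \<and> \<xi> < \<alpha> \<and> f \<iota> \<in>\<^sub>V f \<xi>})"


section \<open>Ordinal Turing machines\<close>

datatype tape = Input | Scratch | Output

datatype direction = Left | Right

text \<open>
  A program maps each of its finitely many states and each triple of symbols under the head to the
  symbols to be written, the head movement and the new state. It stops in a state not of its own.
\<close>

type_synonym program = "nat \<rightharpoonup> ((tape \<Rightarrow> bool) \<Rightarrow> (tape \<Rightarrow> bool) \<times> direction \<times> nat)"

record (overloaded) 'v config =
  state :: nat
  head :: "'v ordinal"
  cells :: "tape \<Rightarrow> 'v ordinal \<Rightarrow> bool"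

text \<open>Moving left from a limit position leads to cell \<open>0\<close>.\<close>

definition move :: "direction \<Rightarrow> 'v::zfc ordinal \<Rightarrow> 'v ordinal"
  where "move d a = (case d of Right \<Rightarrow> succ a
    | Left \<Rightarrow> if \<exists>b. a = succ b then (THE b. a = succ b) else 0)"

text \<open>A halting configuration is repeated forever.\<close>

definition step :: "program \<Rightarrow> 'v::zfc config \<Rightarrow> 'v config"
  where "step P C = (case P (state C) of None \<Rightarrow> C
    | Some \<delta> \<Rightarrow> (let (w, d, q) = \<delta> (\<lambda>k. cells C k (head C)) in
        \<lparr>state = q, head = move d (head C), cells = (\<lambda>k. (cells C k)(head C := w k))\<rparr>))"

text \<open>Inferior limit of \<open>g s\<close> as \<open>s\<close> tends to \<open>t\<close> from below. For cells, \<open>False < True\<close>.\<close>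

definition liminf_at ::
    "'v::zfc ordinal \<Rightarrow> ('v ordinal \<Rightarrow> 'b::conditionally_complete_lattice) \<Rightarrow> 'b"
  where "liminf_at t g = (SUP r\<in>{..<t}. INF s\<in>{r..<t}. g s)"

definition init :: "'v::zfc ordinal \<Rightarrow> 'v ordinal set \<Rightarrow> 'v config"
  where "init \<rho> X = \<lparr>state = 0, head = 0,
    cells = (\<lambda>k a. case k of Input \<Rightarrow> a \<in> X | Scratch \<Rightarrow> a = \<rho> | Output \<Rightarrow> False)\<rparr>"

definition is_computation ::
    "program \<Rightarrow> 'v::zfc config \<Rightarrow> ('v ordinal \<Rightarrow> 'v config) \<Rightarrow> bool"
  where "is_computation P C\<^sub>0 C \<longleftrightarrow> C 0 = C\<^sub>0 \<and> (\<forall>t. C (succ t) = step P (C t)) \<and>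
    (\<forall>t. limit t \<longrightarrow> C t =
      \<lparr>state = liminf_at t (\<lambda>s. state (C s)),
       head = liminf_at t (\<lambda>s. head (C s)),
       cells = (\<lambda>k a. liminf_at t (\<lambda>s. cells (C s) k a))\<rparr>)"

definition halts_with :: "program \<Rightarrow> 'v::zfc ordinal \<Rightarrow> 'v ordinal set \<Rightarrow> 'v ordinal set \<Rightarrow> bool"
  where "halts_with P \<rho> X Y \<longleftrightarrow> (\<exists>C t. is_computation P (init \<rho> X) C \<and>
    P (state (C t)) = None \<and> Y = {a. cells (C t) Output a})"

definition OTM_computes ::
    "program \<Rightarrow> 'v::zfc ordinal \<Rightarrow> ('v ordinal set \<Rightarrow> 'v ordinal set) \<Rightarrow> bool"
  where "OTM_computes P \<rho> G \<longleftrightarrow> finite (dom P) \<and> (\<forall>X\<in>Pow_On. halts_with P \<rho> X (G X))"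


section \<open>Set-theoretic statements and effectivity\<close>

datatype fm = Mem nat nat | Equal nat nat | Neg fm | Conj fm fm | Disj fm fm | Imp fm fm
  | All nat fm | Ex nat fm

primrec sat :: "(nat \<Rightarrow> 'v::zfc) \<Rightarrow> fm \<Rightarrow> bool" where
  "sat e (Mem i j) \<longleftrightarrow> e i \<in>\<^sub>V e j"
| "sat e (Equal i j) \<longleftrightarrow> e i = e j"
| "sat e (Neg \<phi>) \<longleftrightarrow> \<not> sat e \<phi>"
| "sat e (Conj \<phi> \<psi>) \<longleftrightarrow> sat e \<phi> \<and> sat e \<psi>"
| "sat e (Disj \<phi> \<psi>) \<longleftrightarrow> sat e \<phi> \<or> sat e \<psi>"
| "sat e (Imp \<phi> \<psi>) \<longleftrightarrow> (sat e \<phi> \<longrightarrow> sat e \<psi>)"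
| "sat e (All i \<phi>) \<longleftrightarrow> (\<forall>x. sat (e(i := x)) \<phi>)"
| "sat e (Ex i \<phi>) \<longleftrightarrow> (\<exists>x. sat (e(i := x)) \<phi>)"

primrec quantifier_free :: "fm \<Rightarrow> bool" where
  "quantifier_free (Mem i j) \<longleftrightarrow> True"
| "quantifier_free (Equal i j) \<longleftrightarrow> True"
| "quantifier_free (Neg \<phi>) \<longleftrightarrow> quantifier_free \<phi>"
| "quantifier_free (Conj \<phi> \<psi>) \<longleftrightarrow> quantifier_free \<phi> \<and> quantifier_free \<psi>"
| "quantifier_free (Disj \<phi> \<psi>) \<longleftrightarrow> quantifier_free \<phi> \<and> quantifier_free \<psi>"
| "quantifier_free (Imp \<phi> \<psi>) \<longleftrightarrow> quantifier_free \<phi> \<and> quantifier_free \<psi>"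
| "quantifier_free (All i \<phi>) \<longleftrightarrow> False"
| "quantifier_free (Ex i \<phi>) \<longleftrightarrow> False"

primrec free_vars :: "fm \<Rightarrow> nat set" where
  "free_vars (Mem i j) = {i, j}"
| "free_vars (Equal i j) = {i, j}"
| "free_vars (Neg \<phi>) = free_vars \<phi>"
| "free_vars (Conj \<phi> \<psi>) = free_vars \<phi> \<union> free_vars \<psi>"
| "free_vars (Disj \<phi> \<psi>) = free_vars \<phi> \<union> free_vars \<psi>"
| "free_vars (Imp \<phi> \<psi>) = free_vars \<phi> \<union> free_vars \<psi>"
| "free_vars (All i \<phi>) = free_vars \<phi> - {i}"
| "free_vars (Ex i \<phi>) = free_vars \<phi> - {i}"

text \<open>
  The sentence \<open>\<forall>x\<^sub>0 \<exists>y\<^sub>0 \<dots> \<forall>x\<^sub>n \<exists>y\<^sub>n. \<psi>\<close>, where \<open>x\<^sub>i\<close> is variable \<open>2 * i\<close> and \<open>y\<^sub>i\<close> is variable \<open>2 * i + 1\<close>.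
\<close>

definition quantify :: "nat \<Rightarrow> fm \<Rightarrow> fm"
  where "quantify n \<psi> = foldr (\<lambda>i \<phi>. All (2 * i) (Ex (2 * i + 1) \<phi>)) [0..<Suc n] \<psi>"

definition prenex_form :: "fm \<Rightarrow> nat \<Rightarrow> fm \<Rightarrow> bool"
  where "prenex_form \<phi> n \<psi> \<longleftrightarrow>
    quantifier_free \<psi> \<and> free_vars \<psi> \<subseteq> {..<2 * Suc n} \<and> \<phi> = quantify n \<psi>"

definition prenex_statement :: "fm \<Rightarrow> bool"
  where "prenex_statement \<phi> \<longleftrightarrow> (\<exists>n \<psi>. prenex_form \<phi> n \<psi>)"

definition true_in_V :: "'v::zfc itself \<Rightarrow> fm \<Rightarrow> bool"
  where "true_in_V _ \<phi> \<longleftrightarrow> (\<forall>e :: nat \<Rightarrow> 'v. sat e \<phi>)"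

text \<open>The assignment \<open>x\<^sub>i = xs ! i\<close> and \<open>y\<^sub>i = F ((x\<^sub>0, \<dots>, x\<^sub>i))\<close>.\<close>

definition assignment :: "('v::zfc \<Rightarrow> 'v) \<Rightarrow> 'v list \<Rightarrow> nat \<Rightarrow> 'v"
  where "assignment F xs v =
    (if even v then xs ! (v div 2) else F (tuple (take (Suc (v div 2)) xs)))"

definition effectivizer :: "('v::zfc \<Rightarrow> 'v) \<Rightarrow> fm \<Rightarrow> bool"
  where "effectivizer F \<phi> \<longleftrightarrow> (\<exists>n \<psi>. prenex_form \<phi> n \<psi> \<and>
    (\<forall>xs. length xs = Suc n \<longrightarrow> sat (assignment F xs) \<psi>))"

definition encoding :: "('v::zfc ordinal set \<Rightarrow> 'v ordinal set) \<Rightarrow> ('v \<Rightarrow> 'v) \<Rightarrow> bool"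
  where "encoding G F \<longleftrightarrow> G ` Pow_On \<subseteq> Pow_On \<and> (\<forall>c x. codes c x \<longrightarrow> codes (G c) (F x))"

definition OTM_effective :: "'v::zfc itself \<Rightarrow> fm \<Rightarrow> bool"
  where "OTM_effective _ \<phi> \<longleftrightarrow> (\<exists>(F :: 'v \<Rightarrow> 'v) G P \<rho>.
    effectivizer F \<phi> \<and> encoding G F \<and> OTM_computes P \<rho> G)"

end

theory Submission
  imports Defs "HOL-Library.Equipollence"
begin

text \<open>
  An effectivizer is a system of Skolem functions, so effective statements are true. A true statement
  that is not effective is the power set axiom in the prenex form
  \<open>\<forall>x \<exists>y \<forall>z \<exists>w. z \<in> y \<or> (w \<in> z \<and> w \<notin> x)\<close>: it asks for a \<open>y\<close> that contains all subsets of \<open>x\<close>. Its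
  effectivizers strictly raise cardinalities, whereas ordinal Turing machines cannot do this on large
  inputs, as follows.

  Let \<open>B\<close> be an infinite initial segment of the ordinals that contains the parameter and, as a
  subset, the input. If the machine halts at time \<open>t\<close>, then the downward Loewenheim-Skolem argument
  (\<open>Skolem_hull\<close>) yields a class \<open>S\<close> of ordinals that has the cardinality of \<open>B\<close>, contains \<open>t\<close> and
  all of \<open>B\<close>, and has enough witnesses to see how the computation develops, at limit times in
  particular. Let \<open>\<pi>\<close> be the transitive collapse of \<open>S\<close>. It fixes \<open>B\<close>, hence input and parameter, and
  by induction the configuration at time \<open>\<pi> s\<close> is the collapse of the configuration at time \<open>s\<close>, for
  all \<open>s\<close> in \<open>S\<close>. So the machine has already halted at time \<open>\<pi> t \<le> t\<close>, and its output is contained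
  in \<open>\<pi> ` S\<close>, a set no larger than \<open>B\<close> (\<open>halts_with_output_lepoll\<close>).

  Now let \<open>x\<close> be an infinite ordinal above the parameter. The one-term sequence of \<open>x\<close> has a code
  that lies in an initial segment of the cardinality of \<open>x\<close> (\<open>codes_bounded\<close>), because the pairing
  function maps squares of ordinals onto initial segments. The output for this code is thus no larger
  than \<open>x\<close>. But every element of a set leaves its own trace in each code of the set
  (\<open>elts_lepoll_code\<close>), so a code of a set that contains all subsets of \<open>x\<close> is larger than \<open>x\<close>, by
  Cantor's theorem.
\<close>

section \<open>Sets and ordinals\<close>

lemma elts_inject: "elts x = elts y \<Longrightarrow> x = y"
  by (rule extensionality) (auto simp: elts_def set_eq_iff)

lemma mem_iff_elts: "y \<in>\<^sub>V x \<longleftrightarrow> y \<in> elts x"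
  by (simp add: elts_def)

lemma elts_set_of: "elts (set_of (elts x)) = elts x"
proof -
  have "set_of (elts x) = x"
    unfolding set_of_def by (rule the_equality) (auto intro: elts_inject)
  then show ?thesis by simp
qed

lemma ex_set_subset:
  assumes "A \<subseteq> elts x"
  shows "\<exists>y. elts y = A"
proof -
  obtain y where "\<forall>z. z \<in>\<^sub>V y \<longleftrightarrow> z \<in>\<^sub>V x \<and> z \<in> A"
    using separation[of x "\<lambda>z. z \<in> A"] ..
  with assms have "elts y = A"
    by (auto simp: elts_def)
  then show ?thesis ..
qed

lemma elts_set_of_subset: "A \<subseteq> elts x \<Longrightarrow> elts (set_of A) = A"
  using ex_set_subset[of A x] elts_set_of by metis

lemma elts_upair: "elts (upair x y) = {x, y}"
proof -
  obtain u where "x \<in>\<^sub>V u" "y \<in>\<^sub>V u"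
    using pairing by blast
  then have "{x, y} \<subseteq> elts u"
    by (simp add: elts_def)
  then show ?thesis
    unfolding upair_def by (rule elts_set_of_subset)
qed

lemma elts_singleton: "elts (set_of {x}) = {x}"
  using elts_upair[of x x] by (simp add: upair_def)

lemma elts_empty: "elts (set_of {}) = {}"
  by (rule elts_set_of_subset[of _ undefined]) simp

lemma elts_tuple_singleton: "elts (tuple [x]) = {opair (set_of {}) x}"
proof -
  have "{opair (vnat i) ([x] ! i) |i. i < length [x]} = {opair (set_of {}) x}"
    by auto
  then show ?thesis
    by (simp add: tuple_def elts_singleton)
qed

lemma tc_self: "x \<in> tc (set_of {x})"
  by (auto simp: tc_def elts_singleton)

lemma tc_elts: "y \<in> tc x \<Longrightarrow> elts y \<subseteq> tc x"
  unfolding tc_def by blast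

lemma tc_subset: "elts x \<subseteq> T \<Longrightarrow> (\<And>y. y \<in> T \<Longrightarrow> elts y \<subseteq> T) \<Longrightarrow> tc x \<subseteq> T"
  by (auto simp: tc_def)

lemma elts_Rep_ordinal: "elts (Rep_ordinal a) = Rep_ordinal ` {..<a}"
proof (intro equalityI subsetI)
  fix z assume z: "z \<in> elts (Rep_ordinal a)"
  then have "Ord z"
    by (auto simp: elts_def intro: Ord_mem[OF Ord_Rep_ordinal])
  then have "z = Rep_ordinal (Abs_ordinal z)"
    by (simp add: Abs_ordinal_inverse)
  with z show "z \<in> Rep_ordinal ` {..<a}"
    by (intro image_eqI[of _ _ "Abs_ordinal z"]) (auto simp: less_ordinal_def elts_def)
qed (auto simp: less_ordinal_def elts_def)

lemma less_succ: "a < succ a"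
  unfolding succ_def using gt_ex by (rule LeastI_ex)

lemma less_succ_iff: "b < succ a \<longleftrightarrow> b \<le> a"
  by (metis Least_le leD le_less_trans less_succ not_le_imp_less succ_def)

lemma succ_le_iff: "succ a \<le> b \<longleftrightarrow> a < b"
  using less_succ_iff[of b a] by (simp flip: not_less)

lemma succ_inject [simp]: "succ a = succ b \<longleftrightarrow> a = b"
  by (metis less_le_not_le less_succ less_succ_iff linorder_le_cases order_antisym_conv)

lemma zero_le_ordinal [simp]: "(0 :: 'v::zfc ordinal) \<le> a"
  by (simp add: zero_ordinal_def Least_le)

lemma le_zero_ordinal [simp]: "a \<le> (0 :: 'v::zfc ordinal) \<longleftrightarrow> a = 0"
  using order_antisym zero_le_ordinal by blast

lemma limit_pos: "limit t \<Longrightarrow> 0 < t"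
  by (metis limit_def order_less_le zero_le_ordinal)

lemma ordinal_cases:
  obtains (zero) "a = 0" | (succ) b where "a = succ b" | (limit) "limit a"
  unfolding limit_def by blast

text \<open>
  The values lie in a set by replacement, and the union of the ordinals in this set is an ordinal.
\<close>
lemma bdd_above_image_elts: "bdd_above ((f :: 'v::zfc \<Rightarrow> 'v ordinal) ` elts x)"
proof -
  obtain y where y: "\<And>z. z \<in>\<^sub>V x \<Longrightarrow> Rep_ordinal (f z) \<in>\<^sub>V y"
    using replacement[of x "\<lambda>z. Rep_ordinal (f z)"] by blast
  obtain u where u: "\<And>w z. w \<in>\<^sub>V z \<Longrightarrow> z \<in>\<^sub>V y \<Longrightarrow> w \<in>\<^sub>V u"
    using union[of y] by blast
  obtain s where s: "\<forall>w. w \<in>\<^sub>V s \<longleftrightarrow> w \<in>\<^sub>V u \<and> (\<exists>z. z \<in>\<^sub>V x \<and> w \<in>\<^sub>V Rep_ordinal (f z))"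
    using separation[of u "\<lambda>w. \<exists>z. z \<in>\<^sub>V x \<and> w \<in>\<^sub>V Rep_ordinal (f z)"] by blast
  have s': "w \<in>\<^sub>V s \<longleftrightarrow> (\<exists>z. z \<in>\<^sub>V x \<and> w \<in>\<^sub>V Rep_ordinal (f z))" for w
    using s y u by blast
  have "Ord w" if "w \<in>\<^sub>V s" for w
    using that Ord_mem[OF Ord_Rep_ordinal] by (auto simp: s')
  moreover have "transitive_set s"
    unfolding transitive_set_def s' using Ord_trans[OF Ord_Rep_ordinal] by blast
  ultimately have "Ord s"
    by (simp add: Ord_def)
  have "f z \<le> Abs_ordinal s" if "z \<in> elts x" for z
  proof (rule ccontr)
    assume "\<not> f z \<le> Abs_ordinal s"
    then have "s \<in>\<^sub>V Rep_ordinal (f z)"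
      using \<open>Ord s\<close> by (simp add: not_le less_ordinal_def Abs_ordinal_inverse)
    then have "s \<in>\<^sub>V s"
      using that s' by (auto simp: elts_def)
    then show False
      using Ord_irrefl[OF \<open>Ord s\<close>] by blast
  qed
  then show ?thesis
    by (rule bdd_aboveI2)
qed

lemma bdd_above_image_atMost: "bdd_above ((f :: 'v::zfc ordinal \<Rightarrow> 'v ordinal) ` {..a})"
proof -
  have "f ` {..a} = (\<lambda>z. f (Abs_ordinal z)) ` elts (Rep_ordinal (succ a))"
    by (simp add: elts_Rep_ordinal image_image Rep_ordinal_inverse lessThan_def atMost_def
        less_succ_iff)
  then show ?thesis
    using bdd_above_image_elts by metis
qed

lemma downward_closed_eq_lessThan:
  fixes D :: "'v::zfc ordinal set"
  assumes "bdd_above D" and "\<And>a b. a < b \<Longrightarrow> b \<in> D \<Longrightarrow> a \<in> D"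
  shows "\<exists>\<alpha>. D = {..<\<alpha>}"
proof -
  obtain b where "\<forall>a\<in>D. a \<le> b"
    using assms(1) by (auto simp: bdd_above_def)
  then have "succ b \<notin> D"
    using less_succ not_le by blast
  then have *: "(LEAST a. a \<notin> D) \<notin> D"
    by (rule LeastI)
  have "D = {..<LEAST a. a \<notin> D}"
  proof (intro equalityI subsetI)
    fix a assume "a \<in> D"
    then show "a \<in> {..<LEAST a. a \<notin> D}"
      using * assms(2) by (metis lessThan_iff linorder_neqE)
  qed (use not_less_Least in blast)
  then show ?thesis ..
qed

text \<open>
  The axiom of infinity yields a set that contains the finite ordinals, and these are bounded by
  replacement.
\<close>
lemma ex_infinite_ordinal: "\<exists>\<kappa>. \<rho> < \<kappa> \<and> infinite {..<\<kappa> :: 'v::zfc ordinal}"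
proof -
  obtain w e :: 'v where e: "e \<in>\<^sub>V w" "\<forall>z. \<not> z \<in>\<^sub>V e"
    and w: "\<And>x. x \<in>\<^sub>V w \<Longrightarrow> \<exists>y. y \<in>\<^sub>V w \<and> (\<forall>z. z \<in>\<^sub>V y \<longleftrightarrow> z \<in>\<^sub>V x \<or> z = x)"
    using infinity by metis
  define h :: "nat \<Rightarrow> 'v ordinal" where "h n = (succ ^^ n) 0" for n
  have h: "Rep_ordinal (h n) \<in>\<^sub>V w" for n
  proof (induction n)
    case 0
    have "elts (Rep_ordinal (0 :: 'v ordinal)) = {}"
      by (auto simp: elts_Rep_ordinal not_less leD)
    then have "Rep_ordinal (h 0) = e"
      using e(2) by (intro elts_inject) (auto simp: elts_def h_def)
    with e(1) show ?case by simp
  next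
    case (Suc n)
    then obtain y where y: "y \<in>\<^sub>V w" "\<forall>z. z \<in>\<^sub>V y \<longleftrightarrow> z \<in>\<^sub>V Rep_ordinal (h n) \<or> z = Rep_ordinal (h n)"
      using w by blast
    have "{..<succ a} = insert a {..<a}" for a :: "'v ordinal"
      by (auto simp: less_succ_iff)
    then have "elts (Rep_ordinal (h (Suc n))) = insert (Rep_ordinal (h n)) (elts (Rep_ordinal (h n)))"
      by (simp add: elts_Rep_ordinal h_def)
    also have "\<dots> = elts y"
      using y(2) by (auto simp: elts_def)
    finally have "Rep_ordinal (h (Suc n)) = y"
      by (rule elts_inject)
    with y(1) show ?case by simp
  qed
  obtain b where "\<And>z. z \<in> elts w \<Longrightarrow> Abs_ordinal z \<le> b"
    using bdd_above_image_elts[of Abs_ordinal w] by (auto simp: bdd_above_def)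
  then have hb: "h n \<le> b" for n
    using h[of n] by (metis Rep_ordinal_inverse mem_iff_elts)
  have "strict_mono h"
    by (simp add: strict_mono_Suc_iff h_def less_succ)
  then have "infinite (range h)"
    using range_inj_infinite strict_mono_imp_inj_on by blast
  moreover have "range h \<subseteq> {..<succ (max b \<rho>)}"
    using hb by (auto simp: less_succ_iff le_max_iff_disj)
  ultimately have "infinite {..<succ (max b \<rho>)}"
    using infinite_super by blast
  moreover have "\<rho> < succ (max b \<rho>)"
    by (simp add: less_succ_iff)
  ultimately show ?thesis by blast
qed

section \<open>Collapsing well-founded relations to ordinals\<close>

text \<open>
  The height in \<open>R\<close>, counting only elements of \<open>A\<close>. If \<open>R\<close> well-orders \<open>A\<close>, this is its isomorphism
  onto an initial segment of the ordinals. It serves twice: to construct the pairing function, and as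
  the transitive collapse of a class of ordinals. The least ordinal is meaningful only if the values
  at the predecessors are bounded.
\<close>
definition collapse :: "('a \<Rightarrow> 'a \<Rightarrow> bool) \<Rightarrow> 'a set \<Rightarrow> 'a \<Rightarrow> 'v::zfc ordinal"
  where "collapse R A =
    wfrec {(v, u). R v u} (\<lambda>f u. LEAST b. \<forall>v. v \<in> A \<and> R v u \<longrightarrow> f v < b)"

lemma collapse:
  assumes "wfP R"
  shows "collapse R A u = (LEAST b. \<forall>v. v \<in> A \<and> R v u \<longrightarrow> collapse R A v < b)"
proof -
  have "wf {(v, u). R v u}"
    using assms by (simp add: wfp_def)
  from def_wfrec[OF eq_reflection[OF collapse_def] this, of A u] show ?thesis
    by (simp add: cut_apply cong: conj_cong imp_cong)
qed

lemma collapse_mono: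
  fixes R :: "'a \<Rightarrow> 'a \<Rightarrow> bool" and A :: "'a set"
  defines "c \<equiv> collapse R A :: 'a \<Rightarrow> 'v::zfc ordinal"
  assumes "wfP R" and "bdd_above (c ` {v \<in> A. R v u})" and "v \<in> A" and "R v u"
  shows "c v < c u"
proof -
  obtain b where "\<forall>v. v \<in> A \<and> R v u \<longrightarrow> c v \<le> b"
    using assms(3) by (auto simp: bdd_above_def)
  then have *: "\<exists>b. \<forall>v. v \<in> A \<and> R v u \<longrightarrow> c v < b"
    by (intro exI[of _ "succ b"]) (simp add: less_succ_iff)
  have "\<forall>v. v \<in> A \<and> R v u \<longrightarrow> c v < (LEAST b. \<forall>v. v \<in> A \<and> R v u \<longrightarrow> c v < b)"
    using * by (rule LeastI_ex)
  then have "\<forall>v. v \<in> A \<and> R v u \<longrightarrow> c v < c u"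
    unfolding c_def by (subst (2) collapse[OF assms(2)])
  with assms(4,5) show ?thesis by blast
qed

text \<open>
  A minimal \<open>w\<close> whose value is not below \<open>b\<close> has the value \<open>b\<close>, because all its predecessors have
  values below \<open>b\<close>.
\<close>
lemma collapse_image_downward_closed:
  assumes "wfP R" and "b < collapse R A u" and "u \<in> A"
  shows "b \<in> collapse R A ` A"
proof -
  obtain w where w: "w \<in> A" "b \<le> collapse R A w"
      "\<And>v. R v w \<Longrightarrow> \<not> (v \<in> A \<and> b \<le> collapse R A v)"
    using wfp_eq_minimal[THEN iffD1, OF assms(1), rule_format, of u "{v \<in> A. b \<le> collapse R A v}"]
      assms(2,3) by (auto simp: less_imp_le)
  have "collapse R A w \<le> b"
    unfolding collapse[OF assms(1), of A w] by (rule Least_le) (use w(3) not_le in blast)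
  with w show ?thesis
    by (metis image_eqI order_antisym)
qed

text \<open>The Mostowski collapse of a class of ordinals.\<close>

abbreviation ordinal_collapse :: "'v::zfc ordinal set \<Rightarrow> 'v ordinal \<Rightarrow> 'v ordinal"
  where "ordinal_collapse \<equiv> collapse (<)"

text \<open>
  By induction, \<open>s\<close> itself is a strict upper bound of the values at smaller elements of \<open>S\<close>.
\<close>
lemma ordinal_collapse_le: "ordinal_collapse S s \<le> s"
proof (induction s rule: less_induct)
  case (less s)
  show ?case
    unfolding collapse[OF wfp_on_less, of S s]
    by (rule Least_le) (use less.IH le_less_trans in blast)
qed

lemma ordinal_collapse_less: "s \<in> S \<Longrightarrow> s < t \<Longrightarrow> ordinal_collapse S s < ordinal_collapse S t"
proof (rule collapse_mono[OF wfp_on_less])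
  show "bdd_above (ordinal_collapse S ` {v \<in> S. v < t})"
    by (rule bdd_aboveI2[of _ _ t]) (auto intro: order_trans[OF ordinal_collapse_le])
qed auto

lemma ordinal_collapse_less_iff:
  "s \<in> S \<Longrightarrow> t \<in> S \<Longrightarrow> ordinal_collapse S s < ordinal_collapse S t \<longleftrightarrow> s < t"
  by (metis less_asym linorder_neqE ordinal_collapse_less)

lemma ordinal_collapse_eq_iff:
  "s \<in> S \<Longrightarrow> t \<in> S \<Longrightarrow> ordinal_collapse S s = ordinal_collapse S t \<longleftrightarrow> s = t"
  by (metis less_irrefl linorder_neqE ordinal_collapse_less)

lemma ordinal_collapse_downward_closed:
  assumes "b < ordinal_collapse S s" "s \<in> S"
  obtains r where "r \<in> S" "r < s" "b = ordinal_collapse S r"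
  using collapse_image_downward_closed[OF wfp_on_less assms] assms ordinal_collapse_less_iff by blast

lemma ordinal_collapse_fixed:
  assumes "{..s} \<subseteq> S"
  shows "ordinal_collapse S s = s"
proof -
  have "t \<le> s \<Longrightarrow> t \<le> ordinal_collapse S t" for t
  proof (induction t rule: less_induct)
    case (less t)
    show ?case
    proof (rule ccontr)
      assume "\<not> ?case"
      then have *: "ordinal_collapse S t < t" by simp
      with less.prems assms have "ordinal_collapse S t \<in> S" by auto
      from ordinal_collapse_less[OF this *] less.IH[OF *] * less.prems show False by (simp add: leD)
    qed
  qed
  then show ?thesis
    using ordinal_collapse_le by (metis order_antisym order_refl)
qed

section \<open>The pairing function\<close>

lemma pair_less_iff:
  "pair_less (a, b) (c, d) \<longleftrightarrow>
    max a b < max c d \<or> max a b = max c d \<and> (a < c \<or> a = c \<and> b < d)"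
  by (simp add: pair_less_def)

lemma wfP_pair_less: "wfP (pair_less :: 'v::zfc ordinal \<times> 'v ordinal \<Rightarrow> _)"
proof -
  let ?less = "{(a, b :: 'v ordinal). a < b}"
  have "wf (inv_image (?less <*lex*> ?less <*lex*> ?less) (\<lambda>(a, b). (max a b, a, b)))"
    by (intro wf_inv_image wf_lex_prod) (simp_all add: wf)
  moreover have "{(u, v). pair_less u v} =
      inv_image (?less <*lex*> ?less <*lex*> ?less) (\<lambda>(a, b). (max a b, a, b))"
    by (auto simp: pair_less_iff inv_image_def)
  ultimately show ?thesis
    by (simp add: wfp_def)
qed

lemma pair_less_total: "u \<noteq> v \<Longrightarrow> pair_less u v \<or> pair_less v u"
  by (cases u; cases v; simp only: pair_less_iff prod.inject) (metis linorder_neqE)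

lemma pair_less_imp_le_max: "pair_less (c, d) (a, b) \<Longrightarrow> c \<le> max a b \<and> d \<le> max a b"
  by (auto simp: pair_less_iff max_def split: if_splits)

text \<open>
  The predecessors of \<open>(a, b)\<close> lie in a square, and the values on a square are bounded by replacement
  in one coordinate after the other. All ordinals are values, since the values form an initial segment
  and the value at \<open>(a, 0)\<close> is at least \<open>a\<close>.
\<close>
lemma ex_pairing_function:
  defines "p \<equiv> collapse pair_less UNIV :: 'v::zfc ordinal \<times> 'v ordinal \<Rightarrow> 'v ordinal"
  shows "p u < p v \<longleftrightarrow> pair_less u v" and "bij p"
proof -
  have bdd: "bdd_above (p ` {v \<in> UNIV. pair_less v (a, b)})" for a b
  proof -
    define m where "m = max a b"
    obtain B where B: "\<And>c d. d \<le> m \<Longrightarrow> p (c, d) \<le> B c"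
    proof -
      have "\<exists>b. \<forall>d\<le>m. p (c, d) \<le> b" for c
        using bdd_above_image_atMost[of "\<lambda>d. p (c, d)" m] by (auto simp: bdd_above_def)
      then show ?thesis
        using that by metis
    qed
    obtain M where M: "\<And>c. c \<le> m \<Longrightarrow> B c \<le> M"
      using bdd_above_image_atMost[of B m] by (auto simp: bdd_above_def)
    have "p v \<le> M" if "pair_less v (a, b)" for v
    proof (cases v)
      case (Pair c d)
      with that have "c \<le> m" "d \<le> m"
        using pair_less_imp_le_max m_def by blast+
      then show ?thesis
        using order_trans[OF B M] Pair by simp
    qed
    then show ?thesis
      by (auto intro!: bdd_aboveI2)
  qed
  have mono: "p u < p v" if "pair_less u v" for u v
    using collapse_mono[OF wfP_pair_less bdd[of "fst v" "snd v", unfolded p_def], of u] that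
    by (simp add: p_def)
  show "p u < p v \<longleftrightarrow> pair_less u v"
    using mono[of u v] mono[of v u] pair_less_total[of u v] by (auto dest: less_asym)
  have "inj p"
  proof (rule injI)
    fix u v assume "p u = p v"
    then show "u = v"
      using mono[of u v] mono[of v u] pair_less_total[of u v] by auto
  qed
  moreover have "b \<in> range p" for b
  proof -
    have le: "a \<le> p (a, 0)" for a
    proof (induction a rule: less_induct)
      case (less a)
      show ?case
      proof (rule ccontr)
        assume "\<not> ?case"
        then have "p (p (a, 0), 0) < p (a, 0)"
          by (intro mono) (simp add: pair_less_iff not_le max_absorb1)
        with less[of "p (a, 0)"] \<open>\<not> ?case\<close> show False by (simp add: not_le)
      qed
    qed
    have "b < p (succ b, 0)"
      using less_le_trans[OF less_succ le] .
    then show ?thesis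
      unfolding p_def by (rule collapse_image_downward_closed[OF wfP_pair_less]) simp
  qed
  ultimately show "bij p"
    by (auto simp: bij_def)
qed

text \<open>
  Two isomorphisms \<open>p\<close> and \<open>q\<close> that agree below \<open>u\<close> also agree at \<open>u\<close>: otherwise \<open>q u < p u\<close>, say, and
  then \<open>q u = p w = q w\<close> for some \<open>w\<close> below \<open>u\<close>.
\<close>
lemma ord_pair_iso:
  "bij (ord_pair :: 'v::zfc ordinal \<times> 'v ordinal \<Rightarrow> 'v ordinal) \<and>
    (\<forall>u v :: 'v ordinal \<times> 'v ordinal. ord_pair u < ord_pair v \<longleftrightarrow> pair_less u v)"
proof -
  let ?iso = "\<lambda>p :: 'v ordinal \<times> 'v ordinal \<Rightarrow> 'v ordinal.
    bij p \<and> (\<forall>u v. p u < p v \<longleftrightarrow> pair_less u v)"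
  have le: "p u \<le> q u" if p: "?iso p" and q: "?iso q" and IH: "\<And>v. pair_less v u \<Longrightarrow> p v = q v" for p q u
  proof (rule ccontr)
    assume "\<not> ?thesis"
    obtain w where w: "p w = q u"
      using p by (metis bij_pointE)
    with \<open>\<not> ?thesis\<close> p have "pair_less w u"
      by (metis not_le)
    with IH q w show False
      by (metis order_less_irrefl)
  qed
  have "p = q" if "?iso p" "?iso q" for p q
  proof
    fix u
    show "p u = q u"
    proof (induction u rule: wfp_induct_rule[OF wfP_pair_less])
      case (1 u)
      then show ?case
        using le[OF that] le[OF that(2,1)] by (metis order_antisym)
    qed
  qed
  moreover have "?iso (collapse pair_less UNIV)"
    using ex_pairing_function by blast
  ultimately have "\<exists>!p. ?iso p"
    by blast
  from theI'[OF this] show ?thesis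
    by (simp add: ord_pair_def)
qed

lemma ord_pair_less_iff: "ord_pair u < ord_pair v \<longleftrightarrow> pair_less u v"
  using ord_pair_iso by blast

lemma ord_pair_inject: "ord_pair u = ord_pair v \<longleftrightarrow> u = v"
  using ord_pair_iso by (metis bij_pointE)

lemma ord_pair_square_downward_closed:
  assumes "b < c" "c \<in> ord_pair ` ({..<\<alpha>} \<times> {..<\<alpha>})"
  shows "b \<in> ord_pair ` ({..<\<alpha>} \<times> {..<\<alpha>})"
proof -
  obtain i j where ij: "i < \<alpha>" "j < \<alpha>" "c = ord_pair (i, j)"
    using assms(2) by auto
  obtain u where "b = ord_pair u"
    using ord_pair_iso by (metis bij_pointE)
  then obtain k l where kl: "b = ord_pair (k, l)"
    by (metis surj_pair)
  with ij assms(1) have "k \<le> max i j" "l \<le> max i j"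
    using ord_pair_less_iff pair_less_imp_le_max by blast+
  with ij have "k < \<alpha>" "l < \<alpha>"
    by (auto intro: le_less_trans)
  then show ?thesis
    using kl by blast
qed

section \<open>Cardinality and Skolem hulls\<close>

lemma lepoll_iff_card_of: "A \<lesssim> B \<longleftrightarrow> ordLeq3 (card_of A) (card_of B)"
  unfolding lepoll_def by (rule card_of_ordLeq)

lemma UN_lepoll_infinite:
  assumes "infinite B" "I \<lesssim> B" "\<And>i. i \<in> I \<Longrightarrow> A i \<lesssim> B"
  shows "(\<Union>i\<in>I. A i) \<lesssim> B"
  using card_of_UNION_ordLeq_infinite[of B I A] assms by (simp add: lepoll_iff_card_of)

lemma Times_lepoll_infinite:
  assumes "infinite B" "A \<lesssim> B" "A' \<lesssim> B"
  shows "A \<times> A' \<lesssim> B"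
  using card_of_Sigma_ordLeq_infinite[of B A "\<lambda>_. A'"] assms by (simp add: lepoll_iff_card_of)

lemma countable_lepoll_infinite:
  assumes "countable A" "infinite B"
  shows "A \<lesssim> B"
proof -
  have "A \<lesssim> (UNIV :: nat set)"
    using assms(1) by (auto simp: countable_def lepoll_def)
  also have "(UNIV :: nat set) \<lesssim> B"
    using assms(2) by (simp add: infinite_le_lepoll)
  finally show ?thesis .
qed

lemma Un_lepoll_infinite:
  assumes "infinite B" "A \<lesssim> B" "A' \<lesssim> B"
  shows "A \<union> A' \<lesssim> B"
proof -
  have "(\<Union>i\<in>UNIV. if i then A else A') \<lesssim> B"
    using assms by (intro UN_lepoll_infinite) (auto intro: countable_lepoll_infinite)
  then show ?thesis by (simp add: UNIV_bool Un_commute)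
qed

text \<open>
  The downward Loewenheim-Skolem argument: witnesses for parameters that are already present are added
  \<open>\<omega>\<close> times. The members of \<open>Q\<close> are formulas with three parameters \<open>x\<close>, \<open>y\<close>, \<open>z\<close> whose witness is \<open>w\<close>.
\<close>
lemma Skolem_hull:
  fixes Q :: "('a \<Rightarrow> 'a \<Rightarrow> 'a \<Rightarrow> 'a \<Rightarrow> bool) set"
  assumes "countable Q" "infinite B"
  shows "\<exists>S. B \<subseteq> S \<and> S \<lesssim> B \<and>
    (\<forall>q\<in>Q. \<forall>x\<in>S. \<forall>y\<in>S. \<forall>z\<in>S. (\<exists>w. q x y z w) \<longrightarrow> (\<exists>w\<in>S. q x y z w))"
proof -
  define wit where "wit = (\<lambda>(q, x, y, z). SOME w. q (x :: 'a) (y :: 'a) (z :: 'a) (w :: 'a))"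
  define T where "T n = ((\<lambda>X. X \<union> wit ` (Q \<times> X \<times> X \<times> X)) ^^ n) B" for n :: nat
  have T_Suc: "T (Suc n) = T n \<union> wit ` (Q \<times> T n \<times> T n \<times> T n)" for n
    by (simp add: T_def)
  define S where "S = (\<Union>n. T n)"
  have T_lepoll: "T n \<lesssim> B" for n
  proof (induction n)
    case 0
    then show ?case by (simp add: T_def)
  next
    case (Suc n)
    have "wit ` (Q \<times> T n \<times> T n \<times> T n) \<lesssim> Q \<times> T n \<times> T n \<times> T n"
      by (rule image_lepoll)
    also have "\<dots> \<lesssim> B"
      using Suc assms countable_lepoll_infinite[OF assms] by (intro Times_lepoll_infinite)
    finally show ?case
      using Suc assms(2) by (simp add: T_Suc Un_lepoll_infinite)
  qed
  have "S \<lesssim> B"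
    unfolding S_def using assms(2) T_lepoll
    by (intro UN_lepoll_infinite) (auto intro: countable_lepoll_infinite)
  moreover have "B \<subseteq> S"
  proof -
    have "T 0 = B" by (simp add: T_def)
    then show ?thesis by (auto simp: S_def)
  qed
  moreover have "\<exists>w\<in>S. q x y z w"
    if q: "q \<in> Q" and xyz: "x \<in> S" "y \<in> S" "z \<in> S" and ex: "\<exists>w. q x y z w" for q x y z
  proof -
    have mono: "T m \<subseteq> T n" if "m \<le> n" for m n
      by (rule lift_Suc_mono_le[OF _ that]) (auto simp: T_Suc)
    obtain i j k where "x \<in> T i" "y \<in> T j" "z \<in> T k"
      using xyz by (auto simp: S_def)
    then have "x \<in> T (i + j + k)" "y \<in> T (i + j + k)" "z \<in> T (i + j + k)"
      using mono[of i "i + j + k"] mono[of j "i + j + k"] mono[of k "i + j + k"] by auto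
    with q have "wit (q, x, y, z) \<in> T (Suc (i + j + k))"
      unfolding T_Suc by blast
    then have "wit (q, x, y, z) \<in> S"
      by (auto simp: S_def)
    moreover have "q x y z (wit (q, x, y, z))"
      using someI_ex[OF ex] by (simp add: wit_def)
    ultimately show ?thesis ..
  qed
  ultimately show ?thesis
    by (intro exI[of _ S] conjI ballI impI)
qed

section \<open>Codes\<close>

text \<open>
  The element \<open>a\<close> gets the least ordinal, and the other elements get distinct larger ones; collapsing
  these ordinals enumerates \<open>A\<close> with \<open>a\<close> first.
\<close>
lemma ex_enumeration:
  fixes \<kappa> :: "'v::zfc ordinal"
  assumes "A \<lesssim> {..<\<kappa>}" "a \<in> A"
  shows "\<exists>\<alpha> :: 'v ordinal. \<exists>f. bij_betw f {..<\<alpha>} A \<and> f 0 = a"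
proof -
  obtain g where g: "inj_on g A" "g ` A \<subseteq> {..<\<kappa>}"
    using assms(1) by (auto simp: lepoll_def)
  define h where "h x = (if x = a then 0 else succ (g x))" for x
  have succ_pos: "0 < succ b" for b :: "'v ordinal"
    by (simp add: less_succ_iff)
  have h_le: "h x \<le> \<kappa>" if "x \<in> A" for x
    using that g(2) by (auto simp: h_def succ_le_iff)
  have "inj_on h A"
    using g(1) succ_pos by (auto simp: inj_on_def h_def less_le)
  define c where "c x = ordinal_collapse (h ` A) (h x)" for x
  have inj: "inj_on c A"
    using \<open>inj_on h A\<close> by (auto simp: c_def inj_on_def ordinal_collapse_eq_iff)
  have "c ` A = ordinal_collapse (h ` A) ` h ` A"
    by (auto simp: c_def)
  moreover have "bdd_above (c ` A)"
    using h_le by (auto simp: c_def intro!: bdd_aboveI2 order_trans[OF ordinal_collapse_le])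
  ultimately obtain \<alpha> where \<alpha>: "c ` A = {..<\<alpha>}"
    using downward_closed_eq_lessThan[of "c ` A"] collapse_image_downward_closed[OF wfp_on_less]
    by (metis (no_types, lifting) imageE)
  then have "bij_betw (inv_into A c) {..<\<alpha>} A"
    using inj by (metis bij_betw_def bij_betw_inv_into)
  moreover have "c a = 0"
    using ordinal_collapse_le[of "h ` A" "h a"] by (simp add: c_def h_def order_antisym)
  then have "inv_into A c 0 = a"
    using inj assms(2) inv_into_f_f by metis
  ultimately show ?thesis by blast
qed

text \<open>
  A code that enumerates the transitive closure in the length \<open>\<alpha>\<close> lies in the image of \<open>\<alpha> \<times> \<alpha>\<close> under the
  pairing function, which is an initial segment.
\<close>
lemma codes_bounded:
  fixes x :: "'v::zfc" and \<kappa> :: "'v::zfc ordinal"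
  assumes "tc (set_of {x}) \<lesssim> {..<\<kappa>}" "infinite {..<\<kappa>}"
  shows "\<exists>c B. codes c x \<and> c \<in> Pow_On \<and> c \<subseteq> B \<and> B \<lesssim> {..<\<kappa>} \<and>
    (\<forall>a b. a < b \<longrightarrow> b \<in> B \<longrightarrow> a \<in> B)"
proof -
  obtain \<alpha> :: "'v ordinal" and f where f: "bij_betw f {..<\<alpha>} (tc (set_of {x}))" "f 0 = x"
    using ex_enumeration[OF assms(1) tc_self] by blast
  define c where "c = {ord_pair (\<iota>, \<xi>) | \<iota> \<xi>. \<iota> < \<alpha> \<and> \<xi> < \<alpha> \<and> f \<iota> \<in>\<^sub>V f \<xi>}"
  define B where "B = ord_pair ` ({..<\<alpha>} \<times> {..<\<alpha>})"
  have "codes c x"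
    using f by (auto simp: codes_def c_def)
  moreover have "c \<subseteq> B"
    by (auto simp: c_def B_def)
  moreover have "{..<\<alpha>} \<lesssim> {..<\<kappa>}"
    using lepoll_trans1[OF _ assms(1)] f(1) by (auto simp: eqpoll_def)
  then have "B \<lesssim> {..<\<kappa>}"
    unfolding B_def using lepoll_trans[OF image_lepoll] Times_lepoll_infinite[OF assms(2)] by metis
  moreover have "c \<in> Pow_On"
  proof -
    have "B \<subseteq> {..<ord_pair (\<alpha>, \<alpha>)}"
      by (auto simp: B_def ord_pair_less_iff pair_less_iff)
    with \<open>c \<subseteq> B\<close> have "Rep_ordinal ` c \<subseteq> elts (Rep_ordinal (ord_pair (\<alpha>, \<alpha>)))"
      by (auto simp: elts_Rep_ordinal)
    from ex_set_subset[OF this] show ?thesis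
      by (auto simp: Pow_On_def)
  qed
  ultimately show ?thesis
    using ord_pair_square_downward_closed unfolding B_def by blast
qed

text \<open>
  Each element \<open>z\<close> of \<open>x\<close> leaves a trace in the code, namely the pair of indices of \<open>z\<close> and \<open>x\<close>.
\<close>
lemma elts_lepoll_code:
  assumes "codes c x"
  shows "elts x \<lesssim> c"
proof -
  obtain \<alpha> f where f: "bij_betw f {..<\<alpha>} (tc (set_of {x}))" "f 0 = x"
    and c: "c = {ord_pair (\<iota>, \<xi>) | \<iota> \<xi>. \<iota> < \<alpha> \<and> \<xi> < \<alpha> \<and> f \<iota> \<in>\<^sub>V f \<xi>}"
    using assms by (auto simp: codes_def)
  define g where "g = inv_into {..<\<alpha>} f"
  have g: "g z < \<alpha>" "f (g z) = z" if "z \<in> tc (set_of {x})" for z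
    using that f(1) unfolding g_def bij_betw_def by (metis inv_into_into lessThan_iff, metis f_inv_into_f)
  have "0 < \<alpha>"
    using g(1)[OF tc_self] by (metis zero_le_ordinal le_less_trans)
  have sub: "elts x \<subseteq> tc (set_of {x})"
    by (rule tc_elts[OF tc_self])
  have "inj_on (\<lambda>z. ord_pair (g z, 0)) (elts x)"
    using g(2) sub by (auto simp: inj_on_def ord_pair_inject) (metis subsetD)
  moreover have "ord_pair (g z, 0) \<in> c" if "z \<in> elts x" for z
  proof -
    have "z \<in> tc (set_of {x})"
      using that sub by blast
    then have "g z < \<alpha> \<and> 0 < \<alpha> \<and> f (g z) \<in>\<^sub>V f 0"
      using g that \<open>0 < \<alpha>\<close> f(2) by (simp add: mem_iff_elts)
    then show ?thesis
      unfolding c by blast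
  qed
  then have "(\<lambda>z. ord_pair (g z, 0)) ` elts x \<subseteq> c"
    by blast
  ultimately show ?thesis
    by (auto simp: lepoll_def)
qed

text \<open>
  The transitive closure consists of \<open>x\<close>, its elements and the few sets from which the one-term
  sequence of \<open>x\<close> is built.
\<close>
lemma tc_tuple_singleton_lepoll:
  assumes "transitive_set x" "infinite (elts x)"
  shows "tc (set_of {tuple [x]}) \<lesssim> elts x"
proof -
  define e where "e = (set_of {} :: 'a)"
  define N where "N = {tuple [x], opair e x, upair e e, upair e x, e, x}"
  have "tc (set_of {tuple [x]}) \<subseteq> elts x \<union> N"
  proof (rule tc_subset)
    show "elts (set_of {tuple [x]}) \<subseteq> elts x \<union> N"
      by (simp add: elts_singleton N_def)
    fix y assume "y \<in> elts x \<union> N"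
    then show "elts y \<subseteq> elts x \<union> N"
    proof
      assume "y \<in> elts x"
      then show ?thesis
        using assms(1) by (auto simp: transitive_set_def elts_def)
    next
      assume "y \<in> N"
      then show ?thesis
        by (auto simp: N_def elts_tuple_singleton e_def[symmetric] opair_def elts_upair)
          (auto simp: e_def elts_empty)
    qed
  qed
  then have "tc (set_of {tuple [x]}) \<lesssim> elts x \<union> N"
    by (rule subset_imp_lepoll)
  also have "\<dots> \<lesssim> elts x"
    using assms(2) by (intro Un_lepoll_infinite) (auto simp: N_def intro: countable_lepoll_infinite)
  finally show ?thesis .
qed

section \<open>Inferior limits\<close>

text \<open>
  Inferior limits without suprema and infima: both conjuncts ask only for the existence of times below
  \<open>t\<close>, so a Skolem hull can supply them.
\<close>
definition is_liminf :: "'v::zfc ordinal \<Rightarrow> ('v ordinal \<Rightarrow> 'b::linorder) \<Rightarrow> 'b \<Rightarrow> bool"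
  where "is_liminf t g h \<longleftrightarrow>
    (\<forall>b<h. \<exists>r<t. \<forall>s. r \<le> s \<and> s < t \<longrightarrow> b < g s) \<and> (\<forall>r<t. \<exists>s. r \<le> s \<and> s < t \<and> g s \<le> h)"

lemma is_liminf_const: "r < t \<Longrightarrow> (\<And>s. r \<le> s \<Longrightarrow> s < t \<Longrightarrow> g s = h) \<Longrightarrow> is_liminf t g h"
  unfolding is_liminf_def by (metis linorder_le_cases order_refl)

text \<open>
  Since the values are well-ordered, every infimum is attained.
\<close>
lemma liminf_at_eqI:
  fixes g :: "'v::zfc ordinal \<Rightarrow> 'b::{conditionally_complete_linorder, wellorder}"
  assumes "is_liminf t g h" "0 < t"
  shows "liminf_at t g = h"
proof -
  have bdd: "bdd_below (A :: 'b set)" for A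
    by (rule bdd_belowI[of _ "LEAST x. True"]) (simp add: Least_le)
  have le: "(INF s\<in>{r..<t}. g s) \<le> h" if r: "r < t" for r
  proof -
    obtain s where "r \<le> s" "s < t" "g s \<le> h"
      using assms(1) r unfolding is_liminf_def by blast
    then show ?thesis
      by (intro order_trans[OF cINF_lower[OF bdd]]) auto
  qed
  then have bdd': "bdd_above ((\<lambda>r. INF s\<in>{r..<t}. g s) ` {..<t})"
    by (intro bdd_aboveI2) auto
  show ?thesis
  proof (rule order_antisym)
    show "liminf_at t g \<le> h"
      unfolding liminf_at_def using assms(2) le by (intro cSUP_least) auto
    show "h \<le> liminf_at t g"
    proof (rule ccontr)
      assume "\<not> ?thesis"
      then obtain r where r: "r < t" "\<And>s. r \<le> s \<Longrightarrow> s < t \<Longrightarrow> liminf_at t g < g s"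
        using assms(1) unfolding is_liminf_def by (meson not_le)
      define m where "m = (LEAST b. b \<in> g ` {r..<t})"
      have "m \<in> g ` {r..<t}"
        unfolding m_def by (rule LeastI[of "\<lambda>b. b \<in> g ` {r..<t}" "g r"]) (use r(1) in auto)
      then have "liminf_at t g < m"
        using r(2) by auto
      also have "m \<le> (INF s\<in>{r..<t}. g s)"
        using r(1) by (intro cINF_greatest) (auto simp: m_def intro: Least_le)
      also have "\<dots> \<le> liminf_at t g"
        unfolding liminf_at_def using r(1) by (intro cSUP_upper bdd') simp
      finally show False by simp
    qed
  qed
qed

lemma is_liminf_at:
  fixes g :: "'v::zfc ordinal \<Rightarrow> 'b::{conditionally_complete_linorder, wellorder}"
  assumes "0 < t" "\<And>s. s < t \<Longrightarrow> g s \<le> B"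
  shows "is_liminf t g (liminf_at t g)"
proof -
  \<comment> \<open>The inferior limit is the least value that bounds \<open>g\<close> from above at cofinally many times.\<close>
  define h where "h = (LEAST h. \<forall>r<t. \<exists>s. r \<le> s \<and> s < t \<and> g s \<le> h)"
  have "\<forall>r<t. \<exists>s. r \<le> s \<and> s < t \<and> g s \<le> B"
    using assms(2) by blast
  then have "\<forall>r<t. \<exists>s. r \<le> s \<and> s < t \<and> g s \<le> h"
    unfolding h_def by (rule LeastI)
  moreover have "\<exists>r<t. \<forall>s. r \<le> s \<and> s < t \<longrightarrow> b < g s" if "b < h" for b
    using not_less_Least[OF that[unfolded h_def]] by (meson not_le)
  ultimately have "is_liminf t g h"
    by (simp add: is_liminf_def)
  then show ?thesis
    using liminf_at_eqI assms(1) by metis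
qed

lemma liminf_at_bool: "liminf_at t g \<longleftrightarrow> (\<exists>r<t. \<forall>s. r \<le> s \<and> s < t \<longrightarrow> g s)"
  by (simp add: liminf_at_def Bex_def Ball_def)

lemma is_liminf_bool:
  "is_liminf t g h \<longleftrightarrow>
    (h \<longrightarrow> (\<exists>r<t. \<forall>s. r \<le> s \<and> s < t \<longrightarrow> g s)) \<and> (\<not> h \<longrightarrow> (\<forall>r<t. \<exists>s. r \<le> s \<and> s < t \<and> \<not> g s))"
  if "0 < t" for h :: bool
proof (cases h)
  case True
  have "(\<forall>b<True. Q b) \<longleftrightarrow> Q False" for Q
    by (auto simp: less_bool_def)
  moreover have "\<exists>s\<ge>r. s < t" if "r < t" for r
    using that by blast
  ultimately show ?thesis
    using True by (simp add: is_liminf_def)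
qed (simp add: is_liminf_def)

lemma liminf_at_bool_eqI: "is_liminf t g h \<Longrightarrow> 0 < t \<Longrightarrow> liminf_at t g = h" for h :: bool
  unfolding liminf_at_bool using is_liminf_bool[of t g h] by (cases h) auto

lemma is_liminf_at_bool: "0 < t \<Longrightarrow> is_liminf t g (liminf_at t g)" for g :: "_ \<Rightarrow> bool"
  by (simp add: is_liminf_bool liminf_at_bool)

section \<open>Halting computations\<close>

lemma move_le_succ: "move d a \<le> succ a"
proof (cases d)
  case Left
  have "(THE b. a = succ b) \<le> succ a" if "a = succ b" for b
    using that less_succ[of b] less_succ[of a] by (simp add: less_imp_le order.trans)
  with Left show ?thesis
    by (auto simp: move_def)
qed (simp add: move_def)

locale halting_computation =
  fixes P :: program and \<rho> :: "'v::zfc ordinal" and X :: "'v ordinal set"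
    and C :: "'v ordinal \<Rightarrow> 'v config" and t :: "'v ordinal"
  assumes finite_program: "finite (dom P)"
    and computation: "is_computation P (init \<rho> X) C"
    and halted: "P (state (C t)) = None"
begin

lemma C_zero: "C 0 = init \<rho> X"
  and C_succ: "C (succ s) = step P (C s)"
  and C_limit: "limit s \<Longrightarrow> C s =
      \<lparr>state = liminf_at s (\<lambda>s. state (C s)),
       head = liminf_at s (\<lambda>s. head (C s)),
       cells = (\<lambda>k a. liminf_at s (\<lambda>s. cells (C s) k a))\<rparr>"
  using computation unfolding is_computation_def by blast+

lemma state_limit: "limit s \<Longrightarrow> state (C s) = liminf_at s (\<lambda>s. state (C s))"
  and head_limit: "limit s \<Longrightarrow> head (C s) = liminf_at s (\<lambda>s. head (C s))"
  and cells_limit: "limit s \<Longrightarrow> cells (C s) k a = liminf_at s (\<lambda>s. cells (C s) k a)"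
  by (drule C_limit, erule ssubst, simp)+

lemma C_limitI:
  assumes "limit s"
    and "is_liminf s (\<lambda>s. state (C s)) (state D)"
    and "is_liminf s (\<lambda>s. head (C s)) (head D)"
    and "\<And>k a. is_liminf s (\<lambda>s. cells (C s) k a) (cells D k a)"
  shows "C s = (D :: 'v config)"
proof -
  have "(\<lambda>k a. liminf_at s (\<lambda>s. cells (C s) k a)) = cells D"
    using assms by (intro ext liminf_at_bool_eqI limit_pos)
  then show ?thesis
    using assms(2,3) limit_pos[OF assms(1)] by (simp add: C_limit[OF assms(1)] liminf_at_eqI)
qed

text \<open>
  At limit times, the configuration is the inferior limit of eventually constant sequences.
\<close>
lemma constant_after_halting:
  assumes "P (state (C r)) = None" "r \<le> u"
  shows "C u = C r"
  using assms(2)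
proof (induction u rule: less_induct)
  case (less u)
  show ?case
  proof (cases u rule: ordinal_cases)
    case zero
    with less.prems show ?thesis by simp
  next
    case (succ v)
    then consider "r = u" | "r \<le> v"
      using less.prems less_succ_iff by (metis order_le_less)
    then show ?thesis
    proof cases
      case 2
      then have "C v = C r"
        using less.IH succ less_succ by blast
      then show ?thesis
        using assms(1) succ by (simp add: C_succ step_def)
    qed simp
  next
    case limit
    show ?thesis
    proof (cases "r = u")
      case False
      with less.prems have "r < u" by simp
      have C: "C s = C r" if "r \<le> s" "s < u" for s
        using less.IH that by blast
      show ?thesis
        by (rule C_limitI[OF limit]; rule is_liminf_const[OF \<open>r < u\<close>]; drule (1) C; simp)
    qed simp
  qed
qed

text \<open>
  A computation that halts visits only states of the program and its final state. Without a bound, the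
  inferior limit of the states would not be meaningful.
\<close>
lemma bounded_states: "\<exists>M. \<forall>s. state (C s) \<le> M"
proof -
  have "state (C s) \<in> insert (state (C t)) (dom P)" for s
  proof (cases "P (state (C s))")
    case None
    then have "C s = C t"
      using constant_after_halting[of s t] constant_after_halting[OF halted, of s]
      by (metis linorder_le_cases)
    then show ?thesis by simp
  qed auto
  then show ?thesis
    using finite_program by (intro exI[of _ "Max (insert (state (C t)) (dom P))"]) (simp add: Max_ge)
qed

text \<open>
  In one step the head moves at most to the next cell. So the head positions before a time are bounded,
  and their inferior limit is meaningful.
\<close>
lemma head_le: "head (C s) \<le> s"
proof (induction s rule: less_induct)
  case (less s)
  show ?case
  proof (cases s rule: ordinal_cases)
    case zero
    then show ?thesis
      by (simp add: C_zero init_def)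
  next
    case (succ r)
    then have "head (C r) \<le> r"
      using less less_succ by blast
    then have "succ (head (C r)) \<le> s"
      using succ by (simp add: succ_le_iff less_succ_iff)
    moreover have "head (C s) \<le> succ (head (C r))"
      using move_le_succ succ less_imp_le[OF less_succ]
      by (auto simp: C_succ step_def Let_def split: option.split prod.split)
    ultimately show ?thesis by simp
  next
    case limit
    have "is_liminf s (\<lambda>s. head (C s)) (liminf_at s (\<lambda>s. head (C s)))"
      using less by (intro is_liminf_at[of s _ s] limit_pos limit) (auto intro: less_imp_le le_less_trans)
    then have *: "is_liminf s (\<lambda>s. head (C s)) (head (C s))"
      unfolding head_limit[OF limit] .
    show ?thesis
    proof (rule ccontr)
      assume "\<not> ?thesis"
      then obtain r where "r < s" "s < head (C r)"
        using * by (force simp: is_liminf_def)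
      with less[of r] show False by simp
    qed
  qed
qed

lemma is_liminf_state: "limit s \<Longrightarrow> is_liminf s (\<lambda>s. state (C s)) (state (C s))"
proof -
  assume "limit s"
  obtain M where "\<And>s. state (C s) \<le> M"
    using bounded_states by blast
  then have "is_liminf s (\<lambda>s. state (C s)) (liminf_at s (\<lambda>s. state (C s)))"
    using \<open>limit s\<close> by (intro is_liminf_at limit_pos)
  then show ?thesis
    unfolding state_limit[OF \<open>limit s\<close>] .
qed

lemma is_liminf_head: "limit s \<Longrightarrow> is_liminf s (\<lambda>s. head (C s)) (head (C s))"
proof -
  assume "limit s"
  have "is_liminf s (\<lambda>s. head (C s)) (liminf_at s (\<lambda>s. head (C s)))"
    using \<open>limit s\<close> head_le
    by (intro is_liminf_at[of s _ s] limit_pos) (auto intro: less_imp_le le_less_trans)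
  then show ?thesis
    unfolding head_limit[OF \<open>limit s\<close>] .
qed

lemma is_liminf_cells: "limit s \<Longrightarrow> is_liminf s (\<lambda>s. cells (C s) k a) (cells (C s) k a)"
proof -
  assume "limit s"
  have "is_liminf s (\<lambda>s. cells (C s) k a) (liminf_at s (\<lambda>s. cells (C s) k a))"
    using \<open>limit s\<close> by (intro is_liminf_at_bool limit_pos)
  then show ?thesis
    unfolding cells_limit[OF \<open>limit s\<close>] .
qed

end

section \<open>Collapsing a Skolem hull of a halting computation\<close>

context halting_computation
begin

text \<open>
  What a Skolem hull of the computation has to reflect. In each formula \<open>w\<close> is the witness and \<open>s\<close> is a
  time or a cell. The first four formulas put the halting time into the hull and close it under
  successors, predecessors and head positions. The others provide, for times \<open>s\<close>, the times that the
  two conjuncts of \<^const>\<open>is_liminf\<close> claim to exist for the state, the head and each cell \<open>a\<close>. Being no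
  ordinals, the lower bounds for states and the tapes are not parameters but indices of countably many
  formulas.
\<close>
definition hull_formulas :: "('v ordinal \<Rightarrow> 'v ordinal \<Rightarrow> 'v ordinal \<Rightarrow> 'v ordinal \<Rightarrow> bool) set"
  where "hull_formulas =
    {\<lambda>_ _ _ w. w = t,
     \<lambda>s _ _ w. w = succ s,
     \<lambda>s _ _ w. s = succ w,
     \<lambda>s _ _ w. w = head (C s),
     \<lambda>s r _ w. r \<le> w \<and> w < s \<and> state (C w) \<le> state (C s),
     \<lambda>s a _ w. w < s \<and> (\<forall>u. w \<le> u \<and> u < s \<longrightarrow> a < head (C u)),
     \<lambda>s r _ w. r \<le> w \<and> w < s \<and> head (C w) \<le> head (C s)} \<union>
    range (\<lambda>b s _ _ w. w < s \<and> (\<forall>u. w \<le> u \<and> u < s \<longrightarrow> b < state (C u))) \<union>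
    range (\<lambda>k s a _ w. w < s \<and> (\<forall>u. w \<le> u \<and> u < s \<longrightarrow> False < cells (C u) k a)) \<union>
    range (\<lambda>k s a r w. r \<le> w \<and> w < s \<and> cells (C w) k a \<le> cells (C s) k a)"

lemma countable_hull_formulas: "countable hull_formulas"
proof -
  have "finite (UNIV :: tape set)"
    by (rule finite_subset[of _ "{Input, Scratch, Output}"]) (use tape.exhaust in auto)
  then have "countable (range f)" for f :: "tape \<Rightarrow> 'b"
    by (simp add: countable_finite)
  then show ?thesis
    unfolding hull_formulas_def by (intro countable_Un) (auto intro: countable_finite)
qed

end

text \<open>
  The class \<open>S\<close> is a Skolem hull of \<open>B\<close> for these formulas. Its collapse leaves input and parameter
  unchanged because they belong to the initial segment \<open>B\<close>.
\<close>
locale hull = halting_computation P \<rho> X C t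
  for P :: program and \<rho> :: "'v::zfc ordinal" and X :: "'v ordinal set"
    and C :: "'v ordinal \<Rightarrow> 'v config" and t :: "'v ordinal" +
  fixes B S :: "'v ordinal set"
  assumes B_downward_closed: "a < b \<Longrightarrow> b \<in> B \<Longrightarrow> a \<in> B"
    and X_subset: "X \<subseteq> B" and \<rho>_mem: "\<rho> \<in> B" and B_subset: "B \<subseteq> S"
    and witness: "q \<in> hull_formulas \<Longrightarrow> x \<in> S \<Longrightarrow> y \<in> S \<Longrightarrow> z \<in> S \<Longrightarrow> q x y z w \<Longrightarrow>
      \<exists>w\<in>S. q x y z w"
begin

abbreviation \<pi> :: "'v ordinal \<Rightarrow> 'v ordinal"
  where "\<pi> \<equiv> ordinal_collapse S"

lemma zero_mem: "0 \<in> S"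
  using B_downward_closed[of 0 \<rho>] \<rho>_mem B_subset by (cases "\<rho> = 0") (auto simp: less_le)

lemma t_mem: "t \<in> S"
proof -
  have "(\<lambda>_ _ _ w. w = t) \<in> hull_formulas"
    by (simp add: hull_formulas_def)
  from witness[OF this zero_mem zero_mem zero_mem refl] show ?thesis by blast
qed

lemma succ_mem: "s \<in> S \<Longrightarrow> succ s \<in> S"
proof -
  assume s: "s \<in> S"
  have "(\<lambda>s _ _ w. w = succ s) \<in> hull_formulas"
    by (simp add: hull_formulas_def)
  from witness[OF this s zero_mem zero_mem refl] show ?thesis by blast
qed

lemma pred_mem: "succ s \<in> S \<Longrightarrow> s \<in> S"
proof -
  assume s: "succ s \<in> S"
  have "(\<lambda>s _ _ w. s = succ w) \<in> hull_formulas"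
    by (simp add: hull_formulas_def)
  from witness[OF this s zero_mem zero_mem refl] show ?thesis by auto
qed

lemma head_mem: "s \<in> S \<Longrightarrow> head (C s) \<in> S"
proof -
  assume s: "s \<in> S"
  have "(\<lambda>s _ _ w. w = head (C s)) \<in> hull_formulas"
    by (simp add: hull_formulas_def)
  from witness[OF this s zero_mem zero_mem refl] show ?thesis by blast
qed

lemma collapse_zero: "\<pi> 0 = 0"
  using ordinal_collapse_le[of S 0] by simp

lemma collapse_fixed:
  assumes "a \<in> B"
  shows "\<pi> a = a"
proof (rule ordinal_collapse_fixed, rule subsetI)
  fix b assume "b \<in> {..a}"
  then have "b < a \<or> b = a"
    by (simp add: order_le_less)
  then have "b \<in> B"
    using B_downward_closed assms by blast
  then show "b \<in> S"
    using B_subset by blast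
qed

lemma collapse_mem_iff:
  assumes "a \<in> S" "A \<subseteq> B"
  shows "\<pi> a \<in> A \<longleftrightarrow> a \<in> A"
proof
  assume "\<pi> a \<in> A"
  then have "\<pi> a \<in> B"
    using assms(2) by blast
  then have "\<pi> (\<pi> a) = \<pi> a" "\<pi> a \<in> S"
    using collapse_fixed B_subset by blast+
  then have "\<pi> a = a"
    using ordinal_collapse_eq_iff[of "\<pi> a" S a] assms(1) by simp
  then show "a \<in> A"
    using \<open>\<pi> a \<in> A\<close> by simp
next
  assume "a \<in> A"
  then show "\<pi> a \<in> A"
    using collapse_fixed[of a] assms(2) by auto
qed

lemma collapse_succ:
  assumes "s \<in> S"
  shows "\<pi> (succ s) = succ (\<pi> s)"
proof (rule order_antisym)
  show "succ (\<pi> s) \<le> \<pi> (succ s)"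
    using ordinal_collapse_less[OF assms less_succ] by (simp add: succ_le_iff)
  show "\<pi> (succ s) \<le> succ (\<pi> s)"
  proof (rule ccontr)
    assume "\<not> ?thesis"
    then obtain r where r: "r \<in> S" "r < succ s" "succ (\<pi> s) = \<pi> r"
      using ordinal_collapse_downward_closed[OF _ succ_mem[OF assms]] by (metis not_le)
    then have "\<pi> s < \<pi> r"
      using less_succ by metis
    with r assms show False
      by (simp add: ordinal_collapse_less_iff less_succ_iff)
  qed
qed

text \<open>
  Closure of \<open>S\<close> under successors keeps the collapse from turning limits into successors.
\<close>
lemma collapse_eq_succ:
  assumes "s \<in> S" "\<pi> s = succ b"
  obtains r where "r \<in> S" "s = succ r" "b = \<pi> r"
proof -
  obtain r where r: "r \<in> S" "r < s" "b = \<pi> r"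
    using ordinal_collapse_downward_closed[of b S s] assms less_succ by metis
  then have "\<pi> (succ r) = \<pi> s"
    using assms(2) by (simp add: collapse_succ)
  then have "s = succ r"
    using ordinal_collapse_eq_iff assms(1) succ_mem[OF r(1)] by metis
  with r that show ?thesis by blast
qed

lemma collapse_limit:
  assumes "s \<in> S" "limit s"
  shows "limit (\<pi> s)"
proof -
  have "\<pi> 0 < \<pi> s"
    using zero_mem limit_pos[OF assms(2)] by (rule ordinal_collapse_less)
  then have "\<pi> s \<noteq> 0"
    by (simp add: collapse_zero)
  moreover have "\<pi> s \<noteq> succ b" for b
    using collapse_eq_succ[OF assms(1)] assms(2) unfolding limit_def by metis
  ultimately show ?thesis
    by (simp add: limit_def)
qed

lemma collapse_move:
  assumes "a \<in> S"
  shows "\<pi> (move d a) = move d (\<pi> a)"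
proof (cases d)
  case Left
  show ?thesis
  proof (cases "\<exists>b. a = succ b")
    case True
    then obtain b where b: "a = succ b" by blast
    then have "\<pi> a = succ (\<pi> b)"
      using assms pred_mem collapse_succ by blast
    with b Left show ?thesis
      by (simp add: move_def)
  next
    case False
    then have "\<nexists>b. \<pi> a = succ b"
      using collapse_eq_succ[OF assms] by metis
    with False Left show ?thesis
      by (simp add: move_def collapse_zero)
  qed
next
  case Right
  with assms show ?thesis
    by (simp add: move_def collapse_succ)
qed

text \<open>
  Here \<open>\<theta>\<close> translates the values of \<open>g\<close>: it is the identity for states and symbols and \<open>\<pi>\<close> for head
  positions. The times below \<open>\<pi> s\<close> are the images of the times below \<open>s\<close> in \<open>S\<close>, and \<open>S\<close> contains the
  times that are claimed to exist.
\<close>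
lemma is_liminf_collapse:
  fixes g :: "'v ordinal \<Rightarrow> 'b::linorder" and g' :: "'v ordinal \<Rightarrow> 'c::linorder"
  assumes "s \<in> S"
    and low: "\<And>b. b \<in> W \<Longrightarrow> b < h \<Longrightarrow> \<exists>r\<in>S. r < s \<and> (\<forall>u. r \<le> u \<and> u < s \<longrightarrow> b < g u)"
    and att: "\<And>r. r \<in> S \<Longrightarrow> r < s \<Longrightarrow> \<exists>u\<in>S. r \<le> u \<and> u < s \<and> g u \<le> h"
    and mono: "\<And>u v. u \<in> W \<Longrightarrow> v \<in> W \<Longrightarrow> u < v \<Longrightarrow> \<theta> u < \<theta> v"
    and W: "h \<in> W" "\<And>u. u \<in> S \<Longrightarrow> u < s \<Longrightarrow> g u \<in> W"
    and down: "\<And>b. b < \<theta> h \<Longrightarrow> \<exists>b'\<in>W. b' < h \<and> b = \<theta> b'"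
    and eq: "\<And>u. u \<in> S \<Longrightarrow> u < s \<Longrightarrow> g' (\<pi> u) = \<theta> (g u)"
  shows "is_liminf (\<pi> s) g' (\<theta> h)"
  unfolding is_liminf_def
proof (intro conjI allI impI)
  have le_iff: "\<pi> u \<le> \<pi> v \<longleftrightarrow> u \<le> v" if "u \<in> S" "v \<in> S" for u v
    using ordinal_collapse_less_iff[OF that(2,1)] by (simp flip: not_less)
  fix b assume "b < \<theta> h"
  then obtain b' where b': "b' \<in> W" "b' < h" "b = \<theta> b'"
    using down by blast
  then obtain r where r: "r \<in> S" "r < s" "\<And>u. r \<le> u \<Longrightarrow> u < s \<Longrightarrow> b' < g u"
    using low by blast
  have "b < g' v" if v: "\<pi> r \<le> v" "v < \<pi> s" for v
  proof -
    obtain u where u: "u \<in> S" "u < s" "v = \<pi> u"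
      using ordinal_collapse_downward_closed[OF v(2) assms(1)] .
    with v(1) r(1) have "r \<le> u"
      by (simp add: le_iff)
    then have "\<theta> b' < \<theta> (g u)"
      using u r(3) b'(1) W(2) by (intro mono) blast+
    with u b' show ?thesis
      by (simp add: eq)
  qed
  then show "\<exists>r<\<pi> s. \<forall>v. r \<le> v \<and> v < \<pi> s \<longrightarrow> b < g' v"
    using ordinal_collapse_less[OF r(1,2)] by blast
next
  fix v assume "v < \<pi> s"
  then obtain r where r: "r \<in> S" "r < s" "v = \<pi> r"
    using ordinal_collapse_downward_closed[OF _ assms(1)] by blast
  then obtain u where u: "u \<in> S" "r \<le> u" "u < s" "g u \<le> h"
    using att by blast
  then have "\<theta> (g u) \<le> \<theta> h"
    using mono W by (metis order_le_less)
  moreover have "v \<le> \<pi> u"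
    using r u ordinal_collapse_less by (metis order_le_less)
  ultimately show "\<exists>u. v \<le> u \<and> u < \<pi> s \<and> g' u \<le> \<theta> h"
    using u eq ordinal_collapse_less[OF u(1,3)] by metis
qed

text \<open>
  The configuration at time \<open>\<pi> s\<close> is the collapse of the configuration at time \<open>s\<close>. Cells outside the
  initial segment \<open>\<pi> ` S\<close> have not been visited at time \<open>\<pi> s\<close> and are blank.
\<close>
definition reflected :: "'v ordinal \<Rightarrow> bool"
  where "reflected s \<longleftrightarrow>
    state (C (\<pi> s)) = state (C s) \<and> head (C (\<pi> s)) = \<pi> (head (C s)) \<and>
    (\<forall>k. \<forall>a\<in>S. cells (C (\<pi> s)) k (\<pi> a) = cells (C s) k a) \<and>
    (\<forall>k a. a \<notin> \<pi> ` S \<longrightarrow> \<not> cells (C (\<pi> s)) k a)"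

lemma reflected_zero: "reflected 0"
proof -
  have "\<pi> a \<in> X \<longleftrightarrow> a \<in> X" "\<pi> a = \<rho> \<longleftrightarrow> a = \<rho>" if "a \<in> S" for a
    using collapse_mem_iff[OF that, of X] collapse_mem_iff[OF that, of "{\<rho>}"] X_subset \<rho>_mem by auto
  moreover have "a \<in> \<pi> ` S" if "a \<in> B" for a
    using that collapse_fixed B_subset by (metis image_eqI subsetD)
  then have "a \<notin> X" "a \<noteq> \<rho>" if "a \<notin> \<pi> ` S" for a
    using that X_subset \<rho>_mem by blast+
  ultimately show ?thesis
    by (auto simp: reflected_def collapse_zero C_zero init_def split: tape.split)
qed

lemma reflected_succ:
  assumes "r \<in> S" "reflected r"
  shows "reflected (succ r)"
proof -
  have C: "C (\<pi> (succ r)) = step P (C (\<pi> r))"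
    using assms(1) by (simp add: collapse_succ C_succ)
  note refl = assms(2)[unfolded reflected_def]
  have head: "head (C r) \<in> S"
    using assms(1) by (rule head_mem)
  have read: "(\<lambda>k. cells (C (\<pi> r)) k (head (C (\<pi> r)))) = (\<lambda>k. cells (C r) k (head (C r)))"
    using refl head by simp
  show ?thesis
  proof (cases "P (state (C r))")
    case None
    with refl have "P (state (C (\<pi> r))) = None" by simp
    with None refl C show ?thesis
      by (simp add: reflected_def C_succ step_def)
  next
    case (Some \<delta>)
    obtain w d q where \<delta>: "\<delta> (\<lambda>k. cells (C r) k (head (C r))) = (w, d, q)"
      using prod_cases3 by blast
    have 1: "C (succ r) = \<lparr>state = q, head = move d (head (C r)),
        cells = (\<lambda>k. (cells (C r) k)(head (C r) := w k))\<rparr>"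
      using Some \<delta> by (simp add: C_succ step_def)
    have 2: "C (\<pi> (succ r)) = \<lparr>state = q, head = move d (head (C (\<pi> r))),
        cells = (\<lambda>k. (cells (C (\<pi> r)) k)(head (C (\<pi> r)) := w k))\<rparr>"
      using Some \<delta> refl read unfolding C step_def by simp
    show ?thesis
      unfolding reflected_def 1 2
      using refl head by (auto simp: collapse_move ordinal_collapse_eq_iff)
  qed
qed

lemma reflected_limit:
  assumes "s \<in> S" "limit s" and IH: "\<And>r. r \<in> S \<Longrightarrow> r < s \<Longrightarrow> reflected r"
  shows "reflected s"
proof -
  have state: "state (C (\<pi> u)) = state (C u)" and head: "head (C (\<pi> u)) = \<pi> (head (C u))"
    and cells: "a \<in> S \<Longrightarrow> cells (C (\<pi> u)) k (\<pi> a) = cells (C u) k a"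
    and blank: "a \<notin> \<pi> ` S \<Longrightarrow> \<not> cells (C (\<pi> u)) k a"
    if "u \<in> S" "u < s" for u k a
    using IH[OF that] by (simp_all add: reflected_def)
  note liminf = is_liminf_state[OF assms(2)] is_liminf_head[OF assms(2)] is_liminf_cells[OF assms(2)]
  have lim: "limit (\<pi> s)"
    using assms(1,2) by (rule collapse_limit)
  have "is_liminf (\<pi> s) (\<lambda>s. state (C s)) (id (state (C s)))"
  proof (rule is_liminf_collapse[OF assms(1), where W = UNIV and \<theta> = id
        and g = "\<lambda>s. state (C s)"])
    fix b assume "b < state (C s)"
    then obtain r where r: "r < s \<and> (\<forall>u. r \<le> u \<and> u < s \<longrightarrow> b < state (C u))"
      using liminf(1) unfolding is_liminf_def by blast
    have "(\<lambda>s _ _ w. w < s \<and> (\<forall>u. w \<le> u \<and> u < s \<longrightarrow> b < state (C u))) \<in> hull_formulas"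
      by (simp add: hull_formulas_def)
    from witness[OF this assms(1) zero_mem zero_mem r]
    show "\<exists>r\<in>S. r < s \<and> (\<forall>u. r \<le> u \<and> u < s \<longrightarrow> b < state (C u))" .
  next
    fix r assume "r \<in> S" "r < s"
    then obtain u where u: "r \<le> u \<and> u < s \<and> state (C u) \<le> state (C s)"
      using liminf(1) unfolding is_liminf_def by blast
    have "(\<lambda>s r _ w. r \<le> w \<and> w < s \<and> state (C w) \<le> state (C s)) \<in> hull_formulas"
      by (simp add: hull_formulas_def)
    from witness[OF this assms(1) \<open>r \<in> S\<close> zero_mem u]
    show "\<exists>u\<in>S. r \<le> u \<and> u < s \<and> state (C u) \<le> state (C s)" .
  qed (use state in auto)
  moreover have "is_liminf (\<pi> s) (\<lambda>s. head (C s)) (\<pi> (head (C s)))"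
  proof (rule is_liminf_collapse[OF assms(1), where W = S and \<theta> = \<pi>
        and g = "\<lambda>s. head (C s)"])
    fix a assume a: "a \<in> S" "a < head (C s)"
    then obtain r where r: "r < s \<and> (\<forall>u. r \<le> u \<and> u < s \<longrightarrow> a < head (C u))"
      using liminf(2) unfolding is_liminf_def by blast
    have "(\<lambda>s a _ w. w < s \<and> (\<forall>u. w \<le> u \<and> u < s \<longrightarrow> a < head (C u))) \<in> hull_formulas"
      by (simp add: hull_formulas_def)
    from witness[OF this assms(1) a(1) zero_mem r]
    show "\<exists>r\<in>S. r < s \<and> (\<forall>u. r \<le> u \<and> u < s \<longrightarrow> a < head (C u))" .
  next
    fix r assume "r \<in> S" "r < s"
    then obtain u where u: "r \<le> u \<and> u < s \<and> head (C u) \<le> head (C s)"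
      using liminf(2) unfolding is_liminf_def by blast
    have "(\<lambda>s r _ w. r \<le> w \<and> w < s \<and> head (C w) \<le> head (C s)) \<in> hull_formulas"
      by (simp add: hull_formulas_def)
    from witness[OF this assms(1) \<open>r \<in> S\<close> zero_mem u]
    show "\<exists>u\<in>S. r \<le> u \<and> u < s \<and> head (C u) \<le> head (C s)" .
  next
    fix b assume "b < \<pi> (head (C s))"
    then show "\<exists>a\<in>S. a < head (C s) \<and> b = \<pi> a"
      using ordinal_collapse_downward_closed[OF _ head_mem[OF assms(1)]] by metis
  qed (use assms(1) head head_mem ordinal_collapse_less in auto)
  moreover have "is_liminf (\<pi> s) (\<lambda>s. cells (C s) k (\<pi> a)) (id (cells (C s) k a))"
    if a: "a \<in> S" for k a
  proof (rule is_liminf_collapse[OF assms(1), where W = UNIV and \<theta> = id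
        and g = "\<lambda>s. cells (C s) k a"])
    fix b assume b: "b < cells (C s) k a"
    then obtain r where r: "r < s \<and> (\<forall>u. r \<le> u \<and> u < s \<longrightarrow> False < cells (C u) k a)"
      using liminf(3)[of k a] unfolding is_liminf_def by auto
    have "(\<lambda>s a _ w. w < s \<and> (\<forall>u. w \<le> u \<and> u < s \<longrightarrow> False < cells (C u) k a)) \<in> hull_formulas"
      by (simp add: hull_formulas_def)
    from witness[OF this assms(1) a zero_mem r]
    show "\<exists>r\<in>S. r < s \<and> (\<forall>u. r \<le> u \<and> u < s \<longrightarrow> b < cells (C u) k a)"
      using b by auto
  next
    fix r assume "r \<in> S" "r < s"
    then obtain u where u: "r \<le> u \<and> u < s \<and> cells (C u) k a \<le> cells (C s) k a"
      using liminf(3)[of k a] unfolding is_liminf_def by blast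
    have "(\<lambda>s a r w. r \<le> w \<and> w < s \<and> cells (C w) k a \<le> cells (C s) k a) \<in> hull_formulas"
      by (simp add: hull_formulas_def)
    from witness[OF this assms(1) a \<open>r \<in> S\<close> u]
    show "\<exists>u\<in>S. r \<le> u \<and> u < s \<and> cells (C u) k a \<le> cells (C s) k a" .
  qed (use a cells in auto)
  moreover have "\<not> cells (C (\<pi> s)) k a" if "a \<notin> \<pi> ` S" for k a
  proof -
    have "is_liminf (\<pi> s) (\<lambda>s. cells (C s) k a) False"
    proof (rule is_liminf_const[OF limit_pos[OF lim]])
      fix v assume "v < \<pi> s"
      then obtain u where "u \<in> S" "u < s" "v = \<pi> u"
        using ordinal_collapse_downward_closed[OF _ assms(1)] by blast
      then show "cells (C v) k a = False"
        using blank that by blast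
    qed
    then have "cells (C (\<pi> s)) k a = False"
      unfolding cells_limit[OF lim] using limit_pos[OF lim] by (rule liminf_at_bool_eqI)
    then show ?thesis by simp
  qed
  ultimately show ?thesis
    unfolding reflected_def state_limit[OF lim] head_limit[OF lim]
    using limit_pos[OF lim] by (auto simp: liminf_at_eqI liminf_at_bool_eqI cells_limit[OF lim])
qed

lemma reflected: "s \<in> S \<Longrightarrow> reflected s"
proof (induction s rule: less_induct)
  case (less s)
  show ?case
  proof (cases s rule: ordinal_cases)
    case zero
    then show ?thesis
      using reflected_zero by simp
  next
    case (succ r)
    then show ?thesis
      using less reflected_succ pred_mem less_succ by blast
  next
    case limit
    then show ?thesis
      using less reflected_limit by blast
  qed
qed

text \<open>
  The collapsed configuration at time \<open>\<pi> t \<le> t\<close> has the final state, so the computation has stopped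
  by then, with all symbols that are not blank on cells in \<open>\<pi> ` S\<close>.
\<close>
lemma output_subset: "{a. cells (C t) Output a} \<subseteq> \<pi> ` S"
proof -
  have r: "reflected t"
    using t_mem by (rule reflected)
  then have "P (state (C (\<pi> t))) = None"
    using halted by (simp add: reflected_def)
  then have "C t = C (\<pi> t)"
    using ordinal_collapse_le by (rule constant_after_halting)
  moreover have "a \<notin> \<pi> ` S \<Longrightarrow> \<not> cells (C (\<pi> t)) Output a" for a
    using r by (simp add: reflected_def)
  ultimately show ?thesis
    by (intro subsetI) (metis mem_Collect_eq)
qed

end

text \<open>
  An ordinal Turing machine does not raise infinite cardinalities. The initial segment \<open>B\<close> measures
  input and parameter together.
\<close>
theorem halts_with_output_lepoll:
  fixes B :: "'v::zfc ordinal set"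
  assumes "finite (dom P)" and "halts_with P \<rho> X Y"
    and "infinite B" and "\<And>a b. a < b \<Longrightarrow> b \<in> B \<Longrightarrow> a \<in> B" and "X \<subseteq> B" and "\<rho> \<in> B"
  shows "Y \<lesssim> B"
proof -
  obtain C t where "is_computation P (init \<rho> X) C" "P (state (C t)) = None"
    and Y: "Y = {a. cells (C t) Output a}"
    using assms(2) by (auto simp: halts_with_def)
  then interpret halting_computation P \<rho> X C t
    using assms(1) by unfold_locales
  obtain S where S: "B \<subseteq> S" "S \<lesssim> B"
    "\<forall>q\<in>hull_formulas. \<forall>x\<in>S. \<forall>y\<in>S. \<forall>z\<in>S. (\<exists>w. q x y z w) \<longrightarrow> (\<exists>w\<in>S. q x y z w)"
    using Skolem_hull[OF countable_hull_formulas assms(3)] by blast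
  interpret hull P \<rho> X C t B S
    using assms S by unfold_locales blast+
  have "Y \<lesssim> S"
    unfolding Y using output_subset by (rule subset_image_lepoll)
  then show ?thesis
    using S(2) by (rule lepoll_trans)
qed

section \<open>Effectivity implies truth\<close>

lemma sat_cong:
  "quantifier_free \<psi> \<Longrightarrow> (\<And>v. v \<in> free_vars \<psi> \<Longrightarrow> e v = e' v) \<Longrightarrow> sat e \<psi> \<longleftrightarrow> sat e' \<psi>"
  by (induction \<psi>) auto

lemma assignment_append: "v < 2 * length xs \<Longrightarrow> assignment F (xs @ ys) v = assignment F xs v"
  by (auto simp: assignment_def nth_append)

text \<open>
  Induction on the number of remaining quantifier pairs. The list \<open>xs\<close> holds the values chosen so far
  for the universal quantifiers, and the effectivizer answers with the value at the extended tuple.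
\<close>
lemma sat_quantifier_prefix:
  assumes "quantifier_free \<psi>" "free_vars \<psi> \<subseteq> {..<2 * m}"
    and "\<And>xs. length xs = m \<Longrightarrow> sat (assignment F xs) \<psi>"
    and "length xs \<le> m" "\<And>v. v < 2 * length xs \<Longrightarrow> e v = assignment F xs v"
  shows "sat e (foldr (\<lambda>i \<phi>. All (2 * i) (Ex (2 * i + 1) \<phi>)) [length xs..<m] \<psi>)"
  using assms(4,5)
proof (induction "m - length xs" arbitrary: xs e)
  case 0
  then have "length xs = m" by simp
  have "sat (assignment F xs) \<psi>"
    using \<open>length xs = m\<close> by (rule assms(3))
  moreover have "e v = assignment F xs v" if "v \<in> free_vars \<psi>" for v
    using 0 that assms(2) \<open>length xs = m\<close> by auto
  ultimately have "sat e \<psi>"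
    using sat_cong[OF assms(1)] by blast
  with \<open>length xs = m\<close> show ?case by simp
next
  case (Suc d)
  let ?i = "length xs"
  have i: "[?i..<m] = ?i # [length (xs @ [x])..<m]" for x
    using Suc.hyps(2) by (simp add: upt_conv_Cons)
  have "sat (e(2 * ?i := x, 2 * ?i + 1 := F (tuple (xs @ [x]))))
      (foldr (\<lambda>i \<phi>. All (2 * i) (Ex (2 * i + 1) \<phi>)) [length (xs @ [x])..<m] \<psi>)" for x
  proof (rule Suc.hyps(1))
    fix v assume v: "v < 2 * length (xs @ [x])"
    then consider "v = 2 * ?i" | "v = 2 * ?i + 1" | "v < 2 * ?i"
      by force
    then show "(e(2 * ?i := x, 2 * ?i + 1 := F (tuple (xs @ [x])))) v = assignment F (xs @ [x]) v"
    proof cases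
      case 3
      then show ?thesis
        using Suc.prems(2) by (simp add: assignment_append)
    qed (simp_all add: assignment_def)
  qed (use Suc.hyps(2) in auto)
  then show ?case
    unfolding i[of undefined] by (auto simp del: upt_Suc)
qed

lemma OTM_effective_imp_true:
  assumes "OTM_effective TYPE('v::zfc) \<phi>"
  shows "true_in_V TYPE('v) \<phi>"
proof -
  obtain F :: "'v \<Rightarrow> 'v" and n \<psi> where "prenex_form \<phi> n \<psi>"
    "\<And>xs. length xs = Suc n \<Longrightarrow> sat (assignment F xs) \<psi>"
    using assms unfolding OTM_effective_def effectivizer_def by blast
  then show ?thesis
    using sat_quantifier_prefix[of \<psi> "Suc n" F "[]"]
    by (simp add: true_in_V_def prenex_form_def quantify_def del: upt_Suc)
qed

section \<open>A true statement that is not effective\<close>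

text \<open>
  With \<open>x\<^sub>0 = x\<close>, \<open>y\<^sub>0 = y\<close>, \<open>x\<^sub>1 = z\<close> and \<open>y\<^sub>1 = w\<close>, the matrix is \<open>z \<in> y \<or> (w \<in> z \<and> w \<notin> x)\<close>. In this prenex
  form of the power set axiom, \<open>w\<close> witnesses that \<open>z\<close> is not a subset of \<open>x\<close>.
\<close>
definition power_set_matrix :: fm
  where "power_set_matrix = Disj (Mem 2 1) (Conj (Mem 3 2) (Neg (Mem 3 0)))"

lemma prenex_form_power_set: "prenex_form (quantify 1 power_set_matrix) 1 power_set_matrix"
  by (auto simp: prenex_form_def power_set_matrix_def)

lemma true_power_set: "true_in_V TYPE('v::zfc) (quantify 1 power_set_matrix)"
  unfolding true_in_V_def
proof
  fix e :: "nat \<Rightarrow> 'v"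
  have "\<exists>y. \<forall>z. \<exists>w. z \<in>\<^sub>V y \<or> w \<in>\<^sub>V z \<and> \<not> w \<in>\<^sub>V x" for x :: 'v
    using power_set[of x] by metis
  then show "sat e (quantify 1 power_set_matrix)"
    by (simp add: quantify_def power_set_matrix_def numeral_2_eq_2 numeral_3_eq_3)
qed

text \<open>
  An effectivizer of a sentence refers to some way of writing it in prenex form. There is only one,
  because the matrix does not begin with a quantifier.
\<close>
lemma prenex_form_power_set_unique:
  assumes "prenex_form (quantify 1 power_set_matrix) n \<psi>"
  shows "n = 1 \<and> \<psi> = power_set_matrix"
proof (cases n rule: nat.exhaust[case_names 0 Suc])
  case 0
  with assms show ?thesis
    by (auto simp: prenex_form_def quantify_def)
next
  case (Suc m)
  then have "[0..<Suc n] = 0 # 1 # [2..<Suc n]"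
    by (simp add: upt_conv_Cons numeral_2_eq_2 del: upt_Suc)
  then have eq: "power_set_matrix =
      foldr (\<lambda>i \<phi>. All (2 * i) (Ex (2 * i + 1) \<phi>)) [2..<Suc n] \<psi>"
    using assms
    by (simp add: prenex_form_def quantify_def upt_conv_Cons[of _ "Suc (Suc 0)"] del: upt_Suc)
  have "n = 1"
  proof (rule ccontr)
    assume "n \<noteq> 1"
    with Suc have "[2..<Suc n] = 2 # [3..<Suc n]"
      by (simp add: upt_conv_Cons del: upt_Suc)
    with eq show False
      by (simp add: power_set_matrix_def del: upt_Suc)
  qed
  with eq show ?thesis
    by simp
qed

text \<open>
  If \<open>z\<close> is a subset of \<open>x\<close>, then no answer for \<open>w\<close> satisfies the second disjunct.
\<close>
lemma power_set_effectivizer: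
  assumes "effectivizer F (quantify 1 power_set_matrix)" "elts z \<subseteq> elts x"
  shows "z \<in> elts (F (tuple [x]))"
proof -
  have "\<forall>xs. length xs = Suc 1 \<longrightarrow> sat (assignment F xs) power_set_matrix"
    using assms(1) prenex_form_power_set_unique unfolding effectivizer_def by blast
  then have "sat (assignment F [x, z]) power_set_matrix"
    by simp
  then show ?thesis
    using assms(2) by (auto simp: power_set_matrix_def assignment_def elts_def)
qed

text \<open>
  The set \<open>x\<close> is an infinite ordinal above the parameter. A code of its one-term sequence lies in an
  initial segment no larger than \<open>x\<close>, and so does the parameter. The chain of inequalities follows the
  power set of \<open>x\<close> into the value of the effectivizer, from there into the output and back to \<open>x\<close>.
\<close>
lemma not_OTM_effective_power_set:
  "\<not> OTM_effective TYPE('v::zfc) (quantify 1 power_set_matrix)"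
proof
  assume "OTM_effective TYPE('v) (quantify 1 power_set_matrix)"
  then obtain F :: "'v \<Rightarrow> 'v" and G P \<rho> where F: "effectivizer F (quantify 1 power_set_matrix)"
    and G: "encoding G F" and P: "OTM_computes P \<rho> G"
    unfolding OTM_effective_def by blast
  obtain \<kappa> where \<kappa>: "\<rho> < \<kappa>" "infinite {..<\<kappa>}"
    using ex_infinite_ordinal by blast
  define x where "x = Rep_ordinal \<kappa>"
  have x: "elts x = Rep_ordinal ` {..<\<kappa>}"
    by (simp add: x_def elts_Rep_ordinal)
  have inj: "inj_on Rep_ordinal {..<\<kappa>}"
    by (auto simp: inj_on_def Rep_ordinal_inject)
  have "transitive_set x"
    using Ord_Rep_ordinal[of \<kappa>] by (simp add: x_def Ord_def)
  then have "tc (set_of {tuple [x]}) \<lesssim> elts x"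
    using \<kappa>(2) inj by (intro tc_tuple_singleton_lepoll) (simp_all add: x finite_image_iff)
  also have "elts x \<lesssim> {..<\<kappa>}"
    unfolding x by (rule image_lepoll)
  finally obtain c B where c: "codes c (tuple [x])" "c \<in> Pow_On" "c \<subseteq> B"
    and B: "B \<lesssim> {..<\<kappa>}" "\<And>a b. a < b \<Longrightarrow> b \<in> B \<Longrightarrow> a \<in> B"
    using codes_bounded[OF _ \<kappa>(2)] by meson
  have "Pow (elts x) \<lesssim> elts (F (tuple [x]))"
    unfolding lepoll_def
  proof (intro exI conjI)
    have elts: "elts (set_of A) = A" if "A \<in> Pow (elts x)" for A
      using that by (simp add: elts_set_of_subset)
    show "inj_on set_of (Pow (elts x))"
      by (rule inj_on_inverseI[of _ elts]) (rule elts)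
    show "set_of ` Pow (elts x) \<subseteq> elts (F (tuple [x]))"
      using elts by (auto intro: power_set_effectivizer[OF F])
  qed
  also have "\<dots> \<lesssim> G c"
    using G c(1) by (intro elts_lepoll_code) (simp add: encoding_def)
  \<comment> \<open>The segment \<open>B\<close> covers the input, and \<open>{..<\<kappa>}\<close> contains the parameter and is infinite.\<close>
  also have "G c \<lesssim> B \<union> {..<\<kappa>}"
  proof (rule halts_with_output_lepoll)
    show "finite (dom P)" "halts_with P \<rho> c (G c)"
      using P c(2) by (simp_all add: OTM_computes_def)
    show "a \<in> B \<union> {..<\<kappa>}" if "a < b" "b \<in> B \<union> {..<\<kappa>}" for a b
      using that B(2) by auto
  qed (use c(3) \<kappa> in auto)
  also have "\<dots> \<lesssim> {..<\<kappa>}"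
    using \<kappa>(2) B(1) by (intro Un_lepoll_infinite) auto
  also have "\<dots> \<lesssim> elts x"
    using inj by (auto simp: x lepoll_def)
  finally have "Pow (elts x) \<lesssim> elts x" .
  then show False
    using lesspoll_Pow_self lesspoll_trans1 by blast
qed

theorem proposition7:
  shows "(\<forall>\<phi>. prenex_statement \<phi> \<and> OTM_effective TYPE('v::zfc) \<phi> \<longrightarrow> true_in_V TYPE('v) \<phi>) \<and>
    (\<exists>\<phi>. prenex_statement \<phi> \<and> true_in_V TYPE('v) \<phi> \<and> \<not> OTM_effective TYPE('v) \<phi>)"
proof (intro conjI allI impI)
  show "true_in_V TYPE('v) \<phi>" if "prenex_statement \<phi> \<and> OTM_effective TYPE('v) \<phi>" for \<phi>
    using that OTM_effective_imp_true by blast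
  have "prenex_statement (quantify 1 power_set_matrix)"
    using prenex_form_power_set unfolding prenex_statement_def by blast
  then show "\<exists>\<phi>. prenex_statement \<phi> \<and> true_in_V TYPE('v) \<phi> \<and> \<not> OTM_effective TYPE('v) \<phi>"
    using true_power_set not_OTM_effective_power_set by blast
qed

end
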